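(* Let $\Delta_T>0$ with $T/\Delta_T\to\infty$ as $T\to\infty$ (no further restriction on $\Delta_T$). Define the quadratic variation estimator $$\widehat\vartheta^{QV}_{T,\Delta_T}=\frac1T\sum_{i=1}^{\lfloor T/\Delta_T\rfloor}\big(X_{i\Delta_T}-X_{(i-1)\Delta_T}\big)^2.$$ Then for every $\vartheta\in\Theta$, $$\widehat\vartheta^{QV}_{T,\Delta_T}=\vartheta+\big(I_{T,0}(\vartheta)^{-1}+I_{T,\infty}(\vartheta)^{-1}\big)^{1/2}\xi_T,$$ where $I_{T,0}(\vartheta)=T/\vartheta$, $I_{T,\infty}(\vartheta)=\frac{T\Delta_T^{-1}}{2\vartheta^2}$, and $\xi_T\to\mathcal N(0,1)$ in distribution under $\mathbb P^{T,\Delta_T}_\vartheta$ as $T\to\infty$.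
   Context: Under $\mathbb P_\vartheta=\mathbb P^{T,\Delta}_\vartheta$, $X_t=\sum_{i=1}^{N_t}\varepsilon_i$ ($X_0=0$), with $(N_t)$ a homogeneous Poisson process of intensity $\vartheta\in\Theta\subseteq(0,\infty)$ and $\varepsilon_i$ i.i.d., independent of $(N_t)$, $\mathbb P(\varepsilon_i=\pm1)=1/2$; one observes $X_{i\Delta}$, $i=0,\dots,\lfloor T/\Delta\rfloor$. *)

theory Defs
  imports "HOL-Probability.Probability"
begin

text \<open>Poisson process built from i.i.d. exponential inter-arrival times E 0, E 1, ...:
  N_t = number of n >= 1 with E 0 + ... + E (n-1) <= t.\<close>
definition poisson_count :: "(nat \<Rightarrow> 'a \<Rightarrow> real) \<Rightarrow> real \<Rightarrow> 'a \<Rightarrow> nat" where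
  "poisson_count E t \<omega> = card {n::nat. 1 \<le> n \<and> (\<Sum>k<n. E k \<omega>) \<le> t}"

definition cpp :: "(nat \<Rightarrow> 'a \<Rightarrow> real) \<Rightarrow> (nat \<Rightarrow> 'a \<Rightarrow> real) \<Rightarrow> real \<Rightarrow> 'a \<Rightarrow> real" where
  "cpp E eps t \<omega> = (\<Sum>i\<in>{1..poisson_count E t \<omega>}. eps i \<omega>)"

definition qv_est :: "(nat \<Rightarrow> 'a \<Rightarrow> real) \<Rightarrow> (nat \<Rightarrow> 'a \<Rightarrow> real) \<Rightarrow> real \<Rightarrow> real \<Rightarrow> 'a \<Rightarrow> real" where
  "qv_est E eps T \<Delta> \<omega> = (1 / T) *
     (\<Sum>i\<in>{1..nat \<lfloor>T / \<Delta>\<rfloor>}. (cpp E eps (real i * \<Delta>) \<omega> - cpp E eps ((real i - 1) * \<Delta>) \<omega>)\<^sup>2)"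

definition fisher_0 :: "real \<Rightarrow> real \<Rightarrow> real" where
  "fisher_0 \<theta> T = T / \<theta>"

definition fisher_inf :: "real \<Rightarrow> real \<Rightarrow> real \<Rightarrow> real" where
  "fisher_inf \<theta> T \<Delta> = (T / \<Delta>) / (2 * \<theta>\<^sup>2)"

text \<open>The normalised error xi_T, defined so that
  qv_est = theta + (I_0^-1 + I_inf^-1)^(1/2) * xi_T.\<close>
definition qv_xi :: "(nat \<Rightarrow> 'a \<Rightarrow> real) \<Rightarrow> (nat \<Rightarrow> 'a \<Rightarrow> real) \<Rightarrow> real \<Rightarrow> real \<Rightarrow> real \<Rightarrow> 'a \<Rightarrow> real" where
  "qv_xi E eps \<theta> T \<Delta> \<omega> = (qv_est E eps T \<Delta> \<omega> - \<theta>)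
      / sqrt (inverse (fisher_0 \<theta> T) + inverse (fisher_inf \<theta> T \<Delta>))"

end

theory Submission
  imports Defs "HOL-Real_Asymp.Real_Asymp"
begin

text \<open>
  The pairs of waiting times and following jumps form an i.i.d. sequence. The exponential law being
  memoryless, the path seen after time \<open>t\<close> is again such a sequence and is independent of
  \<open>X\<^sub>t\<close>; hence the characteristic function of the sum of the squared increments is an
  \<open>n\<close>-th power, where \<open>n = \<lfloor>T / \<Delta>\<rfloor>\<close>. With \<open>l = \<theta> \<Delta>\<close>, the variable
  \<open>X\<^sub>\<Delta>\<^sup>2 - l\<close> is centred, has variance \<open>l + 2 l\<^sup>2\<close> and third absolute moment at most
  \<open>16 l\<^sup>3 + 15 l\<^sup>2 + l\<close>. After normalisation, Taylor expansion of the characteristic function leaves an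
  error of order \<open>1 / sqrt (\<theta> T) + 1 / sqrt (T / \<Delta>)\<close> for every size of \<open>l\<close>, so no condition on
  \<open>\<Delta>\<close> beyond \<open>T / \<Delta> \<rightarrow> \<infinity>\<close> is required, and Levy's continuity theorem applies.
\<close>

subsection \<open>Path space and the restart property\<close>

text \<open>The pmf is pushed forward to the Borel sets so that the sign law has the same measurable
  sets as the waiting-time law and products of the two stay Borel.\<close>

definition rademacher :: "real measure" where
  "rademacher = distr (measure_pmf (pmf_of_set {1, -1})) borel (\<lambda>x. x)"

definition step_law :: "real \<Rightarrow> (real \<times> real) measure" where
  "step_law \<theta> = density lborel (exponential_density \<theta>) \<Otimes>\<^sub>M rademacher"

definition path_law :: "real \<Rightarrow> (nat \<Rightarrow> real \<times> real) measure" where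
  "path_law \<theta> = (\<Pi>\<^sub>M k\<in>UNIV. step_law \<theta>)"

lemma sets_rademacher [measurable_cong, simp]: "sets rademacher = sets borel"
  by (simp add: rademacher_def)

lemma prob_space_rademacher: "prob_space rademacher"
  unfolding rademacher_def by (rule measure_pmf.prob_space_distr) simp

lemma nn_integral_rademacher:
  assumes "g \<in> borel_measurable borel"
  shows "(\<integral>\<^sup>+z. g z \<partial>rademacher) = (g 1 + g (-1)) / 2"
  unfolding rademacher_def using assms
  by (subst nn_integral_distr) (auto simp: nn_integral_pmf_of_set)

lemma sets_step_law [measurable_cong]: "sets (step_law \<theta>) = sets (borel \<Otimes>\<^sub>M borel)"
  unfolding step_law_def by (intro sets_pair_measure_cong) auto

lemma sets_path_law [measurable_cong]:
  "sets (path_law \<theta>) = sets (\<Pi>\<^sub>M k\<in>UNIV. borel \<Otimes>\<^sub>M borel)"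
  unfolding path_law_def by (intro sets_PiM_cong sets_step_law refl)

lemma space_path_law [simp]: "space (path_law \<theta>) = UNIV"
  using sets_eq_imp_space_eq[OF sets_path_law] by (simp add: space_PiM space_pair_measure)

lemma prob_space_step_law: "\<theta> > 0 \<Longrightarrow> prob_space (step_law \<theta>)"
  unfolding step_law_def
  by (intro prob_space_pair prob_space_exponential_density prob_space_rademacher)

lemma prob_space_path_law: "\<theta> > 0 \<Longrightarrow> prob_space (path_law \<theta>)"
  unfolding path_law_def by (intro prob_space_PiM prob_space_step_law)

lemma measurable_case_nat_path [measurable]:
  "(\<lambda>\<omega>. case_nat p \<omega>) \<in> measurable (path_law \<theta>) (path_law \<theta>)"
proof -
  have "(\<lambda>\<omega>. (\<lambda>k. case_nat p \<omega> k)) \<in> measurable (path_law \<theta>) (\<Pi>\<^sub>M k\<in>UNIV. borel \<Otimes>\<^sub>M borel)"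
    by (rule measurable_abs_UNIV) (auto split: nat.split simp: space_pair_measure)
  then show ?thesis
    by (simp cong: measurable_cong_sets add: sets_path_law)
qed

text \<open>First-step decomposition: putting an independent step in front of a path reproduces
  \<open>path_law \<theta>\<close>, and Fubini splits off the waiting time and the two equally
  likely signs. The induction over arrivals conditions on the first step through it.\<close>

lemma nn_integral_path_law:
  assumes \<theta>: "\<theta> > 0" and F [measurable]: "F \<in> borel_measurable (path_law \<theta>)"
  shows "(\<integral>\<^sup>+\<omega>. F \<omega> \<partial>path_law \<theta>) = (\<integral>\<^sup>+e. ennreal (exponential_density \<theta> e) *
           (((\<integral>\<^sup>+\<omega>. F (case_nat (e, 1) \<omega>) \<partial>path_law \<theta>)
            + (\<integral>\<^sup>+\<omega>. F (case_nat (e, -1) \<omega>) \<partial>path_law \<theta>)) / 2) \<partial>lborel)"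
proof -
  interpret P: prob_space "step_law \<theta>" by (rule prob_space_step_law[OF \<theta>])
  interpret Q: prob_space "path_law \<theta>" by (rule prob_space_path_law[OF \<theta>])
  interpret R: prob_space rademacher by (rule prob_space_rademacher)
  interpret S: sequence_space "step_law \<theta>" ..
  have [measurable]: "(\<lambda>(p, \<omega>). case_nat p \<omega>) \<in> measurable (step_law \<theta> \<Otimes>\<^sub>M path_law \<theta>) (path_law \<theta>)"
    unfolding path_law_def by measurable
  have "path_law \<theta> = distr (step_law \<theta> \<Otimes>\<^sub>M path_law \<theta>) (path_law \<theta>) (\<lambda>(p, \<omega>). case_nat p \<omega>)"
    using S.PiM_iter by (simp add: path_law_def)
  then have "(\<integral>\<^sup>+\<omega>. F \<omega> \<partial>path_law \<theta>) =
      (\<integral>\<^sup>+\<omega>. F \<omega> \<partial>distr (step_law \<theta> \<Otimes>\<^sub>M path_law \<theta>) (path_law \<theta>) (\<lambda>(p, \<omega>). case_nat p \<omega>))"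
    by simp
  also have "\<dots> = (\<integral>\<^sup>+y. F (case_prod case_nat y) \<partial>(step_law \<theta> \<Otimes>\<^sub>M path_law \<theta>))"
    by (subst nn_integral_distr) (auto)
  also have "\<dots> = (\<integral>\<^sup>+p. \<integral>\<^sup>+\<omega>. F (case_nat p \<omega>) \<partial>path_law \<theta> \<partial>step_law \<theta>)"
    by (subst Q.nn_integral_fst[symmetric]) auto
  finally have 1: "(\<integral>\<^sup>+\<omega>. F \<omega> \<partial>path_law \<theta>) = (\<integral>\<^sup>+p. \<integral>\<^sup>+\<omega>. F (case_nat p \<omega>) \<partial>path_law \<theta> \<partial>step_law \<theta>)" .
  define G where "G p = (\<integral>\<^sup>+\<omega>. F (case_nat p \<omega>) \<partial>path_law \<theta>)" for p
  have "(\<lambda>p. \<integral>\<^sup>+\<omega>. F (case_nat p \<omega>) \<partial>path_law \<theta>) \<in> borel_measurable (step_law \<theta>)"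
    by measurable
  then have G [measurable]: "G \<in> borel_measurable (borel \<Otimes>\<^sub>M borel)"
    by (simp add: G_def[abs_def] cong: measurable_cong_sets add: sets_step_law)
  have "(\<integral>\<^sup>+p. G p \<partial>step_law \<theta>) = (\<integral>\<^sup>+e. \<integral>\<^sup>+z. G (e, z) \<partial>rademacher \<partial>density lborel (exponential_density \<theta>))"
    unfolding step_law_def by (subst R.nn_integral_fst[symmetric]) auto
  also have "\<dots> = (\<integral>\<^sup>+e. (G (e, 1) + G (e, -1)) / 2 \<partial>density lborel (exponential_density \<theta>))"
    by (intro nn_integral_cong nn_integral_rademacher) auto
  also have "\<dots> = (\<integral>\<^sup>+e. ennreal (exponential_density \<theta> e) * ((G (e, 1) + G (e, -1)) / 2) \<partial>lborel)"
    by (subst nn_integral_density) auto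
  finally show ?thesis unfolding 1 G_def .
qed

section \<open>Arrival times, the restarted path and memorylessness\<close>

definition arrival :: "(nat \<Rightarrow> real \<times> real) \<Rightarrow> nat \<Rightarrow> real" where
  "arrival \<omega> n = (\<Sum>k<n. fst (\<omega> k))"

text \<open>The path seen after time \<open>t\<close>, when \<open>m\<close> arrivals have occurred up to time \<open>t\<close>.\<close>

definition restart :: "nat \<Rightarrow> real \<Rightarrow> (nat \<Rightarrow> real \<times> real) \<Rightarrow> (nat \<Rightarrow> real \<times> real)" where
  "restart m t \<omega> k = (if k = 0 then (arrival \<omega> (Suc m) - t, snd (\<omega> m)) else \<omega> (m + k))"

text \<open>\<open>walk_mean m h x\<close> is the mean of \<open>h (x + \<epsilon>\<^sub>1 + \<dots> + \<epsilon>\<^sub>m)\<close> for independent random signs.\<close>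

primrec walk_mean :: "nat \<Rightarrow> (real \<Rightarrow> real) \<Rightarrow> real \<Rightarrow> real" where
  "walk_mean 0 h x = h x"
| "walk_mean (Suc m) h x = (walk_mean m h (x + 1) + walk_mean m h (x - 1)) / 2"

lemma walk_mean_nonneg: "(\<And>y. 0 \<le> h y) \<Longrightarrow> 0 \<le> walk_mean m h x"
  by (induction m arbitrary: x) auto

lemma arrival_0 [simp]: "arrival \<omega> 0 = 0"
  by (simp add: arrival_def)

lemma arrival_case_nat [simp]: "arrival (case_nat p \<omega>) (Suc n) = fst p + arrival \<omega> n"
  unfolding arrival_def by (subst sum.lessThan_Suc_shift) simp

lemma sum_snd_case_nat: "(\<Sum>i<Suc m. snd (case_nat p \<omega> i)) = snd p + (\<Sum>i<m. snd (\<omega> i))"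
  by (subst sum.lessThan_Suc_shift) simp

lemma restart_0_case_nat: "restart 0 t (case_nat p \<omega>) = case_nat (fst p - t, snd p) \<omega>"
  by (auto simp: restart_def fun_eq_iff arrival_def split: nat.split)

text \<open>Removing the first step turns a restart at \<open>t\<close> into a restart at
  \<open>t - fst p\<close> with one arrival fewer. Together with the case \<open>m = 0\<close>, this
  is the recursion behind the induction on \<open>m\<close>.\<close>

lemma restart_Suc_case_nat: "restart (Suc m) t (case_nat p \<omega>) = restart m (t - fst p) \<omega>"
  by (auto simp: restart_def fun_eq_iff)

lemma measurable_coord [measurable]:
  "(\<lambda>\<omega>. fst (\<omega> k)) \<in> borel_measurable (path_law \<theta>)"
  "(\<lambda>\<omega>. snd (\<omega> k)) \<in> borel_measurable (path_law \<theta>)"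
  by measurable

lemma measurable_arrival [measurable]: "(\<lambda>\<omega>. arrival \<omega> n) \<in> borel_measurable (path_law \<theta>)"
  unfolding arrival_def by measurable

lemma measurable_restart [measurable]: "restart m t \<in> measurable (path_law \<theta>) (path_law \<theta>)"
proof -
  have "(\<lambda>\<omega>. (\<lambda>k. restart m t \<omega> k)) \<in> measurable (path_law \<theta>) (\<Pi>\<^sub>M k\<in>UNIV. borel \<Otimes>\<^sub>M borel)"
    unfolding restart_def by (rule measurable_abs_UNIV) auto
  then show ?thesis
    by (simp cong: measurable_cong_sets add: sets_path_law)
qed

text \<open>Memorylessness in integral form: after the shift \<open>e = t + y\<close> the density
  factors as \<open>exp (- \<theta> * t)\<close> times the density at \<open>y\<close>.\<close>

lemma exponential_density_restart:
  assumes \<theta>: "\<theta> > 0" and t: "t \<ge> 0" and G [measurable]: "G \<in> borel_measurable borel"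
  shows "(\<integral>\<^sup>+e. ennreal (exponential_density \<theta> e) * (indicator {t<..} e * G (e - t)) \<partial>lborel)
       = ennreal (exp (- \<theta> * t)) * (\<integral>\<^sup>+e. ennreal (exponential_density \<theta> e) * G e \<partial>lborel)"
proof -
  have "(\<integral>\<^sup>+e. ennreal (exponential_density \<theta> e) * (indicator {t<..} e * G (e - t)) \<partial>lborel)
      = (\<integral>\<^sup>+y. ennreal (exponential_density \<theta> (t + y)) * (indicator {t<..} (t + y) * G y) \<partial>lborel)"
    by (subst nn_integral_real_affine[where c=1 and t=t]) auto
  also have "\<dots> = (\<integral>\<^sup>+y. ennreal (exp (- \<theta> * t)) * (ennreal (exponential_density \<theta> y) * G y) \<partial>lborel)"
  proof (rule nn_integral_cong_AE)
    \<comment> \<open>At \<open>y = 0\<close> the sides may differ, as the density is positive there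
      while the indicator of \<open>{t<..}\<close> vanishes; a single point is null. For
      \<open>y < 0\<close> both sides are zero.\<close>
    have "ennreal (exponential_density \<theta> (t + y)) * (indicator {t<..} (t + y) * G y)
       = ennreal (exp (- \<theta> * t)) * (ennreal (exponential_density \<theta> y) * G y)" if "y \<noteq> 0" for y
    proof (cases "y > 0")
      case True
      then have "exponential_density \<theta> (t + y) = exp (- \<theta> * t) * exponential_density \<theta> y"
        using t by (simp add: exponential_density_def exp_add[symmetric] algebra_simps)
      then show ?thesis using True \<theta> by (simp add: ennreal_mult mult.assoc erlang_density_nonneg)
    next
      case False
      with that show ?thesis by (simp add: exponential_density_def)
    qed
    then show "AE y in lborel. ennreal (exponential_density \<theta> (t + y)) * (indicator {t<..} (t + y) * G y)
       = ennreal (exp (- \<theta> * t)) * (ennreal (exponential_density \<theta> y) * G y)"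
      using AE_lborel_singleton[of 0] by auto
  qed
  also have "\<dots> = ennreal (exp (- \<theta> * t)) * (\<integral>\<^sup>+e. ennreal (exponential_density \<theta> e) * G e \<partial>lborel)"
    by (rule nn_integral_cmult) auto
  finally show ?thesis .
qed

text \<open>\<open>erlang_density m \<theta> t / \<theta>\<close> is the Poisson weight of \<open>m\<close> for \<open>t \<ge> 0\<close> and vanishes for
  \<open>t < 0\<close>. Conditioning on the first arrival \<open>e\<close> reduces \<open>(Suc m, t)\<close> to \<open>(m, t - e)\<close>, where
  \<open>t - e\<close> may be negative, and the weights then satisfy the convolution identity of the Erlang densities.\<close>

lemma nn_integral_restart:
  assumes \<theta>: "\<theta> > 0" and h: "\<And>y. 0 \<le> h y" and [measurable]: "h \<in> borel_measurable borel"
    and F [measurable]: "F \<in> borel_measurable (path_law \<theta>)"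
  shows "(\<integral>\<^sup>+\<omega>. indicator {\<omega>. arrival \<omega> m \<le> t \<and> t < arrival \<omega> (Suc m)} \<omega>
            * ennreal (h (x + (\<Sum>i<m. snd (\<omega> i)))) * F (restart m t \<omega>) \<partial>path_law \<theta>)
       = ennreal (erlang_density m \<theta> t / \<theta> * walk_mean m h x) * (\<integral>\<^sup>+\<omega>. F \<omega> \<partial>path_law \<theta>)"
proof (induction m arbitrary: t x)
  case 0
  define G where "G p = (\<integral>\<^sup>+\<omega>. F (case_nat p \<omega>) \<partial>path_law \<theta>)" for p
  interpret Q: prob_space "path_law \<theta>" by (rule prob_space_path_law[OF \<theta>])
  have [measurable]: "(\<lambda>(p, \<omega>). case_nat p \<omega>) \<in> measurable (step_law \<theta> \<Otimes>\<^sub>M path_law \<theta>) (path_law \<theta>)"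
    unfolding path_law_def by measurable
  have "(\<lambda>p. \<integral>\<^sup>+\<omega>. F (case_nat p \<omega>) \<partial>path_law \<theta>) \<in> borel_measurable (step_law \<theta>)"
    by measurable
  then have G [measurable]: "G \<in> borel_measurable (borel \<Otimes>\<^sub>M borel)"
    by (simp add: G_def[abs_def] cong: measurable_cong_sets add: sets_step_law)
  show ?case
  proof (cases "t < 0")
    case True
    \<comment> \<open>Both sides vanish: \<open>arrival \<omega> 0 = 0\<close> exceeds a negative
      \<open>t\<close>, and the Erlang density is zero there.\<close>
    then show ?thesis by (simp add: erlang_density_def)
  next
    case False
    have 1: "(\<integral>\<^sup>+\<omega>. indicator {\<omega>. arrival \<omega> 0 \<le> t \<and> t < arrival \<omega> (Suc 0)} (case_nat (e, z) \<omega>)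
            * ennreal (h (x + (\<Sum>i<0. snd (case_nat (e, z) \<omega> i)))) * F (restart 0 t (case_nat (e, z) \<omega>)) \<partial>path_law \<theta>)
        = ennreal (h x) * (indicator {t<..} e * G (e - t, z))" for e z
      using False by (simp add: restart_0_case_nat G_def nn_integral_cmult[symmetric] indicator_def)
    have "(\<integral>\<^sup>+\<omega>. indicator {\<omega>. arrival \<omega> 0 \<le> t \<and> t < arrival \<omega> (Suc 0)} \<omega>
            * ennreal (h (x + (\<Sum>i<0. snd (\<omega> i)))) * F (restart 0 t \<omega>) \<partial>path_law \<theta>)
       = (\<integral>\<^sup>+e. ennreal (exponential_density \<theta> e) * ((ennreal (h x) * (indicator {t<..} e * G (e - t, 1))
             + ennreal (h x) * (indicator {t<..} e * G (e - t, -1))) / 2) \<partial>lborel)"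
      unfolding 1[symmetric] by (rule nn_integral_path_law[OF \<theta>]) measurable
    also have "\<dots> = (\<integral>\<^sup>+e. ennreal (h x) * (ennreal (exponential_density \<theta> e) * (indicator {t<..} e *
          ((G (e - t, 1) + G (e - t, -1)) / 2))) \<partial>lborel)"
      by (intro nn_integral_cong)
         (simp add: divide_ennreal_def distrib_left distrib_right ac_simps)
    also have "\<dots> = ennreal (h x) * (ennreal (exp (- \<theta> * t)) * (\<integral>\<^sup>+e. ennreal (exponential_density \<theta> e) *
           ((G (e, 1) + G (e, -1)) / 2) \<partial>lborel))"
      using False
      by (subst nn_integral_cmult, measurable) (subst exponential_density_restart[OF \<theta>], auto)
    also have "(\<integral>\<^sup>+e. ennreal (exponential_density \<theta> e) * ((G (e, 1) + G (e, -1)) / 2) \<partial>lborel)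
        = (\<integral>\<^sup>+\<omega>. F \<omega> \<partial>path_law \<theta>)"
      unfolding G_def by (rule nn_integral_path_law[OF \<theta> F, symmetric])
    also have "ennreal (h x) * (ennreal (exp (- \<theta> * t)) * (\<integral>\<^sup>+\<omega>. F \<omega> \<partial>path_law \<theta>))
       = ennreal (erlang_density 0 \<theta> t / \<theta> * walk_mean 0 h x) * (\<integral>\<^sup>+\<omega>. F \<omega> \<partial>path_law \<theta>)"
      using False \<theta> h
      by (simp add: exponential_density_def ennreal_mult[symmetric] mult.assoc[symmetric] ac_simps)
    finally show ?thesis .
  qed
next
  case (Suc m)
  let ?J = "\<integral>\<^sup>+\<omega>. F \<omega> \<partial>path_law \<theta>"
  have nn: "0 \<le> walk_mean m h y" for y using h by (rule walk_mean_nonneg)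
  have 1: "(\<integral>\<^sup>+\<omega>. indicator {\<omega>. arrival \<omega> (Suc m) \<le> t \<and> t < arrival \<omega> (Suc (Suc m))} (case_nat (e, z) \<omega>)
            * ennreal (h (x + (\<Sum>i<Suc m. snd (case_nat (e, z) \<omega> i)))) * F (restart (Suc m) t (case_nat (e, z) \<omega>)) \<partial>path_law \<theta>)
        = ennreal (erlang_density m \<theta> (t - e) / \<theta> * walk_mean m h (x + z)) * ?J" for e z
    unfolding Suc.IH[of "t - e" "x + z", symmetric] restart_Suc_case_nat sum_snd_case_nat
    by (intro nn_integral_cong) (auto simp: indicator_def algebra_simps)
  have "(\<integral>\<^sup>+\<omega>. indicator {\<omega>. arrival \<omega> (Suc m) \<le> t \<and> t < arrival \<omega> (Suc (Suc m))} \<omega>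
            * ennreal (h (x + (\<Sum>i<Suc m. snd (\<omega> i)))) * F (restart (Suc m) t \<omega>) \<partial>path_law \<theta>)
     = (\<integral>\<^sup>+e. ennreal (exponential_density \<theta> e) *
          ((ennreal (erlang_density m \<theta> (t - e) / \<theta> * walk_mean m h (x + 1)) * ?J
          + ennreal (erlang_density m \<theta> (t - e) / \<theta> * walk_mean m h (x + -1)) * ?J) / 2) \<partial>lborel)"
    unfolding 1[symmetric] by (rule nn_integral_path_law[OF \<theta>]) measurable
  \<comment> \<open>Averaging over the two signs is the recursion of \<open>walk_mean\<close>; what
    is left under the integral is the convolution of two Erlang densities.\<close>
  also have "\<dots> = (\<integral>\<^sup>+e. (ennreal (erlang_density m \<theta> (t - e)) * ennreal (exponential_density \<theta> e)) *
        (ennreal (walk_mean (Suc m) h x / \<theta>) * ?J) \<partial>lborel)"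
  proof (intro nn_integral_cong)
    fix e
    let ?a = "erlang_density m \<theta> (t - e)" and ?b = "exponential_density \<theta> e"
    have ab: "0 \<le> ?a" "0 \<le> ?b" using \<theta> by (auto intro: erlang_density_nonneg)
    have c: "0 \<le> walk_mean (Suc m) h x / \<theta>"
      using \<theta> walk_mean_nonneg[of h "Suc m" x] h by simp
    have "(ennreal (?a / \<theta> * walk_mean m h (x + 1)) * ?J + ennreal (?a / \<theta> * walk_mean m h (x + -1)) * ?J) / 2
       = ennreal ((?a / \<theta> * walk_mean m h (x + 1) + ?a / \<theta> * walk_mean m h (x + -1)) / 2) * ?J"
      using ab \<theta> nn
      by (subst ennreal_divide_numeral[symmetric])
         (auto simp: ennreal_plus distrib_right distrib_left divide_ennreal_def ac_simps)
    also have "(?a / \<theta> * walk_mean m h (x + 1) + ?a / \<theta> * walk_mean m h (x + -1)) / 2 = ?a * (walk_mean (Suc m) h x / \<theta>)"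
      using \<theta> by (simp add: field_simps)
    finally show "ennreal ?b * ((ennreal (?a / \<theta> * walk_mean m h (x + 1)) * ?J + ennreal (?a / \<theta> * walk_mean m h (x + -1)) * ?J) / 2)
       = (ennreal ?a * ennreal ?b) * (ennreal (walk_mean (Suc m) h x / \<theta>) * ?J)"
      using ab c by (simp only: ennreal_mult ac_simps)
  qed
  also have "\<dots> = ennreal (erlang_density (Suc m) \<theta> t) * (ennreal (walk_mean (Suc m) h x / \<theta>) * ?J)"
    using fun_cong[OF convolution_erlang_density[OF \<theta>, of m 0], of t]
    by (subst nn_integral_multc) auto
  also have "\<dots> = ennreal (erlang_density (Suc m) \<theta> t / \<theta> * walk_mean (Suc m) h x) * ?J"
    using \<theta> walk_mean_nonneg[of h "Suc m" x] h
    by (simp add: ennreal_mult[symmetric] mult.assoc[symmetric] erlang_density_nonneg del: walk_mean.simps)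
  finally show ?case .
qed

lemma measurable_poisson_count [measurable]:
  assumes [measurable]: "\<And>k. E k \<in> borel_measurable M"
  shows "poisson_count E t \<in> measurable M (count_space UNIV)"
  unfolding poisson_count_def[abs_def] by measurable

lemma measurable_cpp [measurable]:
  assumes [measurable]: "\<And>k. E k \<in> borel_measurable M" "\<And>k. eps k \<in> borel_measurable M"
  shows "cpp E eps t \<in> borel_measurable M"
proof -
  have "(\<lambda>\<omega>. (\<lambda>n \<omega>. \<Sum>i\<in>{1..n}. eps i \<omega>) (poisson_count E t \<omega>) \<omega>) \<in> borel_measurable M"
    by (rule measurable_compose_countable) measurable
  then show ?thesis by (simp add: cpp_def[abs_def])
qed

subsection \<open>The compound Poisson process on path space\<close>

text \<open>The jump \<open>eps 0\<close> is never used by \<open>cpp\<close>; on path space the jump with index \<open>k \<ge> 1\<close> is paired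
  with the waiting time \<open>k - 1\<close> preceding it.\<close>

abbreviation path_count :: "real \<Rightarrow> (nat \<Rightarrow> real \<times> real) \<Rightarrow> nat" where
  "path_count \<equiv> poisson_count (\<lambda>k \<omega>. fst (\<omega> k))"

abbreviation path_cpp :: "real \<Rightarrow> (nat \<Rightarrow> real \<times> real) \<Rightarrow> real" where
  "path_cpp \<equiv> cpp (\<lambda>k \<omega>. fst (\<omega> k)) (\<lambda>k \<omega>. snd (\<omega> (k - Suc 0)))"

definition positive_path :: "(nat \<Rightarrow> real \<times> real) \<Rightarrow> bool" where
  "positive_path \<omega> \<longleftrightarrow> (\<forall>k. 0 < fst (\<omega> k))"

text \<open>Unlike the equation \<open>path_count t \<omega> = m\<close>, which also holds for \<open>m = 0\<close> when infinitely many
  arrivals precede \<open>t\<close>, this excludes explosion.\<close>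

definition arrivals_at :: "nat \<Rightarrow> real \<Rightarrow> (nat \<Rightarrow> real \<times> real) \<Rightarrow> bool" where
  "arrivals_at m t \<omega> \<longleftrightarrow> positive_path \<omega> \<and> arrival \<omega> m \<le> t \<and> t < arrival \<omega> (Suc m)"

lemma measurable_positive_path [measurable]: "Measurable.pred (path_law \<theta>) positive_path"
  unfolding positive_path_def[abs_def] by measurable

lemma measurable_arrivals_at [measurable]: "Measurable.pred (path_law \<theta>) (arrivals_at m t)"
  unfolding arrivals_at_def[abs_def] by measurable

text \<open>The exponential density vanishes on negative numbers and \<open>{0}\<close> is null;
  since there are countably many coordinates, one common exceptional set suffices.\<close>

lemma AE_positive_path:
  assumes \<theta>: "\<theta> > 0" shows "AE \<omega> in path_law \<theta>. positive_path \<omega>"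
proof -
  interpret R: prob_space rademacher by (rule prob_space_rademacher)
  have "AE e in density lborel (exponential_density \<theta>). 0 < e"
  proof (subst AE_density)
    show "AE e in lborel. 0 < ennreal (exponential_density \<theta> e) \<longrightarrow> 0 < e"
      using AE_lborel_singleton[of "0::real"]
      by eventually_elim (simp add: exponential_density_def)
  qed simp
  then have "AE e in distr (step_law \<theta>) (density lborel (exponential_density \<theta>)) fst. 0 < e"
    unfolding step_law_def R.distr_pair_fst .
  then have "AE p in step_law \<theta>. 0 < fst p"
    by (rule AE_distrD[rotated]) (unfold step_law_def, rule measurable_fst)
  then have "AE \<omega> in path_law \<theta>. 0 < fst (\<omega> k)" for k
    unfolding path_law_def by (intro AE_PiM_component prob_space_step_law[OF \<theta>]) auto
  then show ?thesis unfolding positive_path_def by (simp add: AE_all_countable)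
qed

lemma strict_mono_arrival: "positive_path \<omega> \<Longrightarrow> strict_mono (arrival \<omega>)"
  by (rule strict_monoI_Suc) (simp add: arrival_def positive_path_def)

lemma arrivals_at_unique:
  assumes "arrivals_at m t \<omega>" "arrivals_at n t \<omega>" shows "m = n"
proof -
  have "strict_mono (arrival \<omega>)" using assms strict_mono_arrival by (auto simp: arrivals_at_def)
  moreover have "arrival \<omega> m < arrival \<omega> (Suc n)" "arrival \<omega> n < arrival \<omega> (Suc m)"
    using assms by (auto simp: arrivals_at_def)
  ultimately show ?thesis by (auto simp: strict_mono_less)
qed

text \<open>Strict growth of the arrivals makes the counted index set exactly \<open>{1..m}\<close>,
  hence finite, so \<open>card\<close> returns the true count.\<close>

lemma poisson_count_eq:
  assumes "arrivals_at m t \<omega>" shows "path_count t \<omega> = m"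
proof -
  have sm: "strict_mono (arrival \<omega>)" using assms strict_mono_arrival by (auto simp: arrivals_at_def)
  have le: "arrival \<omega> n \<le> t \<longleftrightarrow> n \<le> m" for n
  proof
    assume "arrival \<omega> n \<le> t"
    then have "arrival \<omega> n < arrival \<omega> (Suc m)" using assms by (simp add: arrivals_at_def)
    then show "n \<le> m" using sm by (simp add: strict_mono_less)
  next
    assume "n \<le> m"
    then have "arrival \<omega> n \<le> arrival \<omega> m" using sm by (simp add: strict_mono_less_eq)
    then show "arrival \<omega> n \<le> t" using assms by (simp add: arrivals_at_def)
  qed
  have "{n. 1 \<le> n \<and> (\<Sum>k<n. fst (\<omega> k)) \<le> t} = {1..m}"
    unfolding arrival_def[symmetric] le by auto
  then show ?thesis by (simp add: poisson_count_def)
qed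

lemma path_cpp_eq:
  assumes "arrivals_at m t \<omega>" shows "path_cpp t \<omega> = (\<Sum>i<m. snd (\<omega> i))"
proof -
  have "path_cpp t \<omega> = (\<Sum>i\<in>{1..m}. snd (\<omega> (i - 1)))"
    by (simp add: cpp_def poisson_count_eq[OF assms])
  also have "\<dots> = (\<Sum>i<m. snd (\<omega> i))"
    by (rule sum.reindex_bij_witness[of _ Suc "\<lambda>i. i - 1"]) auto
  finally show ?thesis .
qed

text \<open>Beyond \<open>t\<close> the restarted path has the old arrivals, with index moved by
  \<open>m\<close> and time moved by \<open>t\<close>; those in \<open>(t, t + s]\<close> are the
  ones with index from \<open>m + 1\<close> to \<open>m'\<close>.\<close>

lemma restart_arrivals_at:
  assumes m: "arrivals_at m t \<omega>" and m': "arrivals_at m' (t + s) \<omega>" and s: "0 \<le> s"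
  shows "m \<le> m'" "arrivals_at (m' - m) s (restart m t \<omega>)"
proof -
  have pos: "positive_path \<omega>" using m by (simp add: arrivals_at_def)
  have sm: "strict_mono (arrival \<omega>)" using pos by (rule strict_mono_arrival)
  have "arrival \<omega> m < arrival \<omega> (Suc m')"
    using m m' s by (auto simp: arrivals_at_def)
  then show le: "m \<le> m'" using sm by (simp add: strict_mono_less)
  have pos': "positive_path (restart m t \<omega>)"
    using pos m by (auto simp: positive_path_def restart_def arrivals_at_def)
  \<comment> \<open>This holds from index one on only: \<open>arrival _ 0\<close> is
    \<open>0\<close>, while \<open>arrival \<omega> m - t\<close> may be negative. Hence the
    separate case \<open>m' = m\<close> below.\<close>
  have arr: "arrival (restart m t \<omega>) (Suc n) = arrival \<omega> (Suc (m + n)) - t" for n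
    by (induction n) (simp_all add: arrival_def restart_def)
  show "arrivals_at (m' - m) s (restart m t \<omega>)"
  proof (cases "m' - m")
    case 0
    then show ?thesis using le m' s pos' arr[of 0] by (auto simp: arrivals_at_def)
  next
    case (Suc n)
    then have "m' = Suc (m + n)" using le by simp
    then show ?thesis using m' Suc pos' arr[of n] arr[of "Suc n"] by (auto simp: arrivals_at_def)
  qed
qed

text \<open>A restart shortens only the first remaining waiting time and leaves the signs unchanged,
  so the increment after \<open>t\<close> is the sum of the first \<open>m' - m\<close> signs of the
  restarted path.\<close>

lemma path_cpp_add:
  assumes m: "arrivals_at m t \<omega>" and m': "arrivals_at m' (t + s) \<omega>" and s: "0 \<le> s"
  shows "path_cpp (t + s) \<omega> = path_cpp t \<omega> + path_cpp s (restart m t \<omega>)"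
proof -
  have le: "m \<le> m'" by (rule restart_arrivals_at[OF assms])
  have split: "(\<Sum>i<m + n. snd (\<omega> i)) = (\<Sum>i<m. snd (\<omega> i)) + (\<Sum>i<n. snd (\<omega> (m + i)))" for n
    by (induction n) (simp_all add: algebra_simps)
  have "(\<Sum>i<m'. snd (\<omega> i)) = (\<Sum>i<m. snd (\<omega> i)) + (\<Sum>i<m' - m. snd (\<omega> (m + i)))"
    using split[of "m' - m"] le by simp
  also have "(\<Sum>i<m' - m. snd (\<omega> (m + i))) = (\<Sum>i<m' - m. snd (restart m t \<omega> i))"
    by (intro sum.cong) (auto simp: restart_def)
  finally show ?thesis
    using path_cpp_eq[OF m] path_cpp_eq[OF m'] path_cpp_eq[OF restart_arrivals_at(2)[OF assms]] by simp
qed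

section \<open>Poisson weights; stationarity and independence after a restart\<close>

definition poisson_weight :: "real \<Rightarrow> nat \<Rightarrow> real" where
  "poisson_weight l m = l ^ m * exp (- l) / fact m"

lemma poisson_weight_nonneg: "0 \<le> l \<Longrightarrow> 0 \<le> poisson_weight l m"
  by (simp add: poisson_weight_def)

lemma poisson_weight_sums: "poisson_weight l sums 1"
proof -
  have "(\<lambda>m. exp (- l) * (l ^ m /\<^sub>R fact m)) sums (exp (- l) * exp l)"
    by (intro sums_mult exp_converges)
  then show ?thesis
    by (simp add: poisson_weight_def[abs_def] exp_minus field_simps)
qed

lemma suminf_ennreal_poisson_weight: "0 \<le> l \<Longrightarrow> (\<Sum>m. ennreal (poisson_weight l m)) = 1"
  by (subst suminf_ennreal_eq[OF _ poisson_weight_sums]) (auto simp: poisson_weight_nonneg)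

lemma erlang_density_poisson_weight:
  "\<theta> > 0 \<Longrightarrow> t \<ge> 0 \<Longrightarrow> erlang_density m \<theta> t / \<theta> = poisson_weight (\<theta> * t) m"
  by (simp add: erlang_density_def poisson_weight_def power_mult_distrib)

text \<open>On this event \<open>path_count\<close> is \<open>m\<close> and \<open>path_cpp\<close>
  is a sum of \<open>m\<close> signs, so the claim is the restart formula started at
  \<open>x = 0\<close>, up to the null set of paths that are not positive.\<close>

lemma nn_integral_arrivals_at:
  assumes \<theta>: "\<theta> > 0" and t: "t \<ge> 0" and h: "\<And>y. 0 \<le> h y" and [measurable]: "h \<in> borel_measurable borel"
    and F [measurable]: "F \<in> borel_measurable (path_law \<theta>)"
  shows "(\<integral>\<^sup>+\<omega>. indicator {\<omega>. arrivals_at m t \<omega>} \<omega> * (ennreal (h (path_cpp t \<omega>))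
            * F (restart (path_count t \<omega>) t \<omega>)) \<partial>path_law \<theta>)
       = ennreal (poisson_weight (\<theta> * t) m * walk_mean m h 0) * (\<integral>\<^sup>+\<omega>. F \<omega> \<partial>path_law \<theta>)"
proof -
  have "(\<integral>\<^sup>+\<omega>. indicator {\<omega>. arrivals_at m t \<omega>} \<omega> * (ennreal (h (path_cpp t \<omega>))
            * F (restart (path_count t \<omega>) t \<omega>)) \<partial>path_law \<theta>)
    = (\<integral>\<^sup>+\<omega>. indicator {\<omega>. arrival \<omega> m \<le> t \<and> t < arrival \<omega> (Suc m)} \<omega>
            * ennreal (h (0 + (\<Sum>i<m. snd (\<omega> i)))) * F (restart m t \<omega>) \<partial>path_law \<theta>)"
    by (rule nn_integral_cong_AE, use AE_positive_path[OF \<theta>] in eventually_elim)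
       (auto simp: indicator_def path_cpp_eq poisson_count_eq, auto simp: arrivals_at_def)
  also have "\<dots> = ennreal (poisson_weight (\<theta> * t) m * walk_mean m h 0) * (\<integral>\<^sup>+\<omega>. F \<omega> \<partial>path_law \<theta>)"
    using nn_integral_restart[OF \<theta> h assms(4) F, of m t 0]
    by (simp only: erlang_density_poisson_weight[OF \<theta> t])
  finally show ?thesis .
qed

lemma walk_mean_const [simp]: "walk_mean m (\<lambda>_. c) x = c"
  by (induction m arbitrary: x) auto

text \<open>Explosion has probability zero because the Poisson weights sum to one.\<close>

lemma AE_arrivals_at:
  assumes \<theta>: "\<theta> > 0" and t: "t \<ge> 0"
  shows "AE \<omega> in path_law \<theta>. \<exists>m. arrivals_at m t \<omega>"
proof -
  interpret Q: prob_space "path_law \<theta>" by (rule prob_space_path_law[OF \<theta>])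
  let ?A = "\<lambda>m. {\<omega>. arrivals_at m t \<omega>}"
  have [measurable]: "?A m \<in> sets (path_law \<theta>)" for m
    using measurable_arrivals_at[of m t \<theta>] unfolding pred_def by simp
  have e: "emeasure (path_law \<theta>) (?A m) = ennreal (poisson_weight (\<theta> * t) m)" for m
    using nn_integral_arrivals_at[OF \<theta> t, of "\<lambda>_. 1" "\<lambda>_. 1" m] by (simp add: Q.emeasure_space_1[simplified])
  have "disjoint_family ?A"
    by (auto simp: disjoint_family_on_def dest: arrivals_at_unique)
  then have "(\<Sum>m. emeasure (path_law \<theta>) (?A m)) = emeasure (path_law \<theta>) (\<Union>m. ?A m)"
    by (intro suminf_emeasure) auto
  moreover have "(\<Sum>m. emeasure (path_law \<theta>) (?A m)) = 1"
    unfolding e using \<theta> t by (simp add: suminf_ennreal_poisson_weight)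
  ultimately have "emeasure (path_law \<theta>) (\<Union>m. ?A m) = 1" by simp
  then have "AE \<omega> in path_law \<theta>. \<omega> \<in> (\<Union>m. ?A m)"
    by (intro Q.AE_prob_1) (simp add: Q.emeasure_eq_measure)
  then show ?thesis by simp
qed

lemma measurable_restart_path_count [measurable]:
  "(\<lambda>\<omega>. restart (path_count t \<omega>) t \<omega>) \<in> measurable (path_law \<theta>) (path_law \<theta>)"
  by (rule measurable_compose_countable[of "\<lambda>m \<omega>. restart m t \<omega>"]) measurable

text \<open>The integral of \<open>F\<close> is the same factor for each number \<open>m\<close> of
  arrivals, so it survives the summation over \<open>m\<close>. This factorisation gives both the
  law of the restarted path and its independence from \<open>path_cpp t\<close>.\<close>

lemma nn_integral_path_cpp_restart:
  assumes \<theta>: "\<theta> > 0" and t: "t \<ge> 0" and h: "\<And>y. 0 \<le> h y" and [measurable]: "h \<in> borel_measurable borel"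
    and F [measurable]: "F \<in> borel_measurable (path_law \<theta>)"
  shows "(\<integral>\<^sup>+\<omega>. ennreal (h (path_cpp t \<omega>)) * F (restart (path_count t \<omega>) t \<omega>) \<partial>path_law \<theta>)
       = (\<Sum>m. ennreal (poisson_weight (\<theta> * t) m * walk_mean m h 0)) * (\<integral>\<^sup>+\<omega>. F \<omega> \<partial>path_law \<theta>)"
proof -
  let ?f = "\<lambda>\<omega>. ennreal (h (path_cpp t \<omega>)) * F (restart (path_count t \<omega>) t \<omega>)"
  have [measurable]: "{\<omega>. arrivals_at m t \<omega>} \<in> sets (path_law \<theta>)" for m
    using measurable_arrivals_at[of m t \<theta>] unfolding pred_def by simp
  have "(\<integral>\<^sup>+\<omega>. ?f \<omega> \<partial>path_law \<theta>)
      = (\<integral>\<^sup>+\<omega>. (\<Sum>m. indicator {\<omega>. arrivals_at m t \<omega>} \<omega> * ?f \<omega>) \<partial>path_law \<theta>)"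
  proof (rule nn_integral_cong_AE, use AE_arrivals_at[OF \<theta> t] in eventually_elim)
    fix \<omega> assume "\<exists>m. arrivals_at m t \<omega>"
    then obtain m where m: "arrivals_at m t \<omega>" ..
    then have "(\<Sum>n. indicator {\<omega>. arrivals_at n t \<omega>} \<omega> * ?f \<omega>) = (\<Sum>n\<in>{m}. indicator {\<omega>. arrivals_at n t \<omega>} \<omega> * ?f \<omega>)"
      by (intro suminf_finite) (auto simp: indicator_def dest: arrivals_at_unique)
    then show "?f \<omega> = (\<Sum>m. indicator {\<omega>. arrivals_at m t \<omega>} \<omega> * ?f \<omega>)"
      using m by simp
  qed
  also have "\<dots> = (\<Sum>m. \<integral>\<^sup>+\<omega>. indicator {\<omega>. arrivals_at m t \<omega>} \<omega> * ?f \<omega> \<partial>path_law \<theta>)"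
    by (rule nn_integral_suminf) measurable
  also have "\<dots> = (\<Sum>m. ennreal (poisson_weight (\<theta> * t) m * walk_mean m h 0)) * (\<integral>\<^sup>+\<omega>. F \<omega> \<partial>path_law \<theta>)"
    unfolding nn_integral_arrivals_at[OF assms] by simp
  finally show ?thesis .
qed

lemma nn_integral_path_cpp:
  assumes "\<theta> > 0" "t \<ge> 0" "\<And>y. 0 \<le> h y" "h \<in> borel_measurable borel"
  shows "(\<integral>\<^sup>+\<omega>. ennreal (h (path_cpp t \<omega>)) \<partial>path_law \<theta>)
       = (\<Sum>m. ennreal (poisson_weight (\<theta> * t) m * walk_mean m h 0))"
  using nn_integral_path_cpp_restart[OF assms, of "\<lambda>_. 1"]
    prob_space.emeasure_space_1[OF prob_space_path_law[OF assms(1)]] by simp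

text \<open>With \<open>h = 1\<close> the first factor of the factorisation is the total Poisson
  mass one, so only the integral of \<open>F\<close> remains.\<close>

lemma distr_restart:
  assumes \<theta>: "\<theta> > 0" and t: "t \<ge> 0"
  shows "distr (path_law \<theta>) (path_law \<theta>) (\<lambda>\<omega>. restart (path_count t \<omega>) t \<omega>) = path_law \<theta>"
proof (rule measure_eqI)
  let ?R = "\<lambda>\<omega>. restart (path_count t \<omega>) t \<omega>"
  fix A assume "A \<in> sets (distr (path_law \<theta>) (path_law \<theta>) ?R)"
  then have A [measurable]: "A \<in> sets (path_law \<theta>)" by simp
  have "emeasure (distr (path_law \<theta>) (path_law \<theta>) ?R) A = (\<integral>\<^sup>+\<omega>. indicator A \<omega> \<partial>distr (path_law \<theta>) (path_law \<theta>) ?R)"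
    by simp
  also have "\<dots> = (\<integral>\<^sup>+\<omega>. ennreal 1 * indicator A (?R \<omega>) \<partial>path_law \<theta>)"
    by (subst nn_integral_distr) auto
  also have "\<dots> = (\<Sum>m. ennreal (poisson_weight (\<theta> * t) m * walk_mean m (\<lambda>_. 1) 0)) * (\<integral>\<^sup>+\<omega>. indicator A \<omega> \<partial>path_law \<theta>)"
    by (rule nn_integral_path_cpp_restart[OF \<theta> t]) auto
  also have "\<dots> = emeasure (path_law \<theta>) A"
    using \<theta> t by (simp add: suminf_ennreal_poisson_weight)
  finally show "emeasure (distr (path_law \<theta>) (path_law \<theta>) ?R) A = emeasure (path_law \<theta>) A" .
qed simp

text \<open>Taking indicators for \<open>h\<close> and \<open>F\<close> in the factorisation makes
  the joint law a product on rectangles, and these determine it.\<close>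

lemma indep_var_path_cpp_restart:
  assumes \<theta>: "\<theta> > 0" and t: "t \<ge> 0"
    and f [measurable]: "f \<in> borel_measurable borel" and g [measurable]: "g \<in> borel_measurable (path_law \<theta>)"
  shows "prob_space.indep_var (path_law \<theta>) borel (\<lambda>\<omega>. f (path_cpp t \<omega>) :: real)
           borel (\<lambda>\<omega>. g (restart (path_count t \<omega>) t \<omega>) :: real)"
proof -
  interpret Q: prob_space "path_law \<theta>" by (rule prob_space_path_law[OF \<theta>])
  let ?R = "\<lambda>\<omega>. restart (path_count t \<omega>) t \<omega>"
  let ?X = "\<lambda>\<omega>. f (path_cpp t \<omega>)" and ?Y = "\<lambda>\<omega>. g (?R \<omega>)"
  have X [measurable]: "?X \<in> borel_measurable (path_law \<theta>)" by measurable
  have Y [measurable]: "?Y \<in> borel_measurable (path_law \<theta>)" by measurable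
  have "distr (path_law \<theta>) borel ?Y = distr (distr (path_law \<theta>) (path_law \<theta>) ?R) borel g"
    by (subst distr_distr) (auto simp: comp_def)
  \<comment> \<open>By stationarity the restarted path may be replaced by the original one in the
    second marginal.\<close>
  then have Y_eq: "distr (path_law \<theta>) borel ?Y = distr (path_law \<theta>) borel g"
    by (simp add: distr_restart[OF \<theta> t])
  have "distr (path_law \<theta>) borel ?X \<Otimes>\<^sub>M distr (path_law \<theta>) borel ?Y
     = distr (path_law \<theta>) (borel \<Otimes>\<^sub>M borel) (\<lambda>\<omega>. (?X \<omega>, ?Y \<omega>))"
  proof (rule pair_measure_eqI)
    show "sigma_finite_measure (distr (path_law \<theta>) borel ?X)"
      by (intro prob_space_imp_sigma_finite Q.prob_space_distr X)
    show "sigma_finite_measure (distr (path_law \<theta>) borel ?Y)"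
      by (intro prob_space_imp_sigma_finite Q.prob_space_distr Y)
    show "sets (distr (path_law \<theta>) borel ?X \<Otimes>\<^sub>M distr (path_law \<theta>) borel ?Y) =
      sets (distr (path_law \<theta>) (borel \<Otimes>\<^sub>M borel) (\<lambda>\<omega>. (?X \<omega>, ?Y \<omega>)))"
      by (simp cong: sets_pair_measure_cong)
    fix A B assume "A \<in> sets (distr (path_law \<theta>) borel ?X)" and "B \<in> sets (distr (path_law \<theta>) borel ?Y)"
    then have [measurable]: "A \<in> sets borel" "B \<in> sets borel" by simp_all
    have "emeasure (distr (path_law \<theta>) borel ?X) A = (\<integral>\<^sup>+x. indicator A x \<partial>distr (path_law \<theta>) borel ?X)"
      by simp
    also have "\<dots> = (\<integral>\<^sup>+\<omega>. ennreal (indicator A (?X \<omega>)) \<partial>path_law \<theta>)"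
      by (subst nn_integral_distr) (auto simp: ennreal_indicator)
    also have "\<dots> = (\<Sum>m. ennreal (poisson_weight (\<theta> * t) m * walk_mean m (\<lambda>y. indicator A (f y)) 0))"
      by (rule nn_integral_path_cpp[OF \<theta> t, of "\<lambda>y. indicator A (f y)"]) auto
    finally have 1: "emeasure (distr (path_law \<theta>) borel ?X) A = \<dots>" .
    have "emeasure (distr (path_law \<theta>) borel ?Y) B = (\<integral>\<^sup>+x. indicator B x \<partial>distr (path_law \<theta>) borel g)"
      unfolding Y_eq by simp
    also have "\<dots> = (\<integral>\<^sup>+\<omega>. indicator B (g \<omega>) \<partial>path_law \<theta>)"
      by (subst nn_integral_distr) auto
    finally have 2: "emeasure (distr (path_law \<theta>) borel ?Y) B = \<dots>" .
    have "emeasure (distr (path_law \<theta>) (borel \<Otimes>\<^sub>M borel) (\<lambda>\<omega>. (?X \<omega>, ?Y \<omega>))) (A \<times> B)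
      = (\<integral>\<^sup>+x. indicator (A \<times> B) x \<partial>distr (path_law \<theta>) (borel \<Otimes>\<^sub>M borel) (\<lambda>\<omega>. (?X \<omega>, ?Y \<omega>)))"
      by simp
    also have "\<dots> = (\<integral>\<^sup>+\<omega>. indicator (A \<times> B) (?X \<omega>, ?Y \<omega>) \<partial>path_law \<theta>)"
      by (rule nn_integral_distr) measurable
    also have "\<dots> = (\<integral>\<^sup>+\<omega>. ennreal (indicator A (?X \<omega>)) * indicator B (g (?R \<omega>)) \<partial>path_law \<theta>)"
      by (simp add: ennreal_indicator indicator_times)
    also have "\<dots> = (\<Sum>m. ennreal (poisson_weight (\<theta> * t) m * walk_mean m (\<lambda>y. indicator A (f y)) 0))
        * (\<integral>\<^sup>+\<omega>. indicator B (g \<omega>) \<partial>path_law \<theta>)"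
      by (rule nn_integral_path_cpp_restart[OF \<theta> t, of "\<lambda>y. indicator A (f y)" "\<lambda>\<omega>. indicator B (g \<omega>)"]) auto
    finally show "emeasure (distr (path_law \<theta>) borel ?X) A * emeasure (distr (path_law \<theta>) borel ?Y) B =
       emeasure (distr (path_law \<theta>) (borel \<Otimes>\<^sub>M borel) (\<lambda>\<omega>. (?X \<omega>, ?Y \<omega>))) (A \<times> B)"
      unfolding 1 2 by simp
  qed
  then show ?thesis
    by (simp add: Q.indep_var_distribution_eq)
qed

subsection \<open>Transfer to path space\<close>

text \<open>The two events are disjoint with total probability one, so \<open>X\<close> is 1 or -1
  almost surely and integrals reduce to two atoms.\<close>

lemma (in prob_space) distr_eq_rademacher:
  assumes [measurable]: "X \<in> borel_measurable M"
    and p: "prob {\<omega>\<in>space M. X \<omega> = 1} = 1/2" "prob {\<omega>\<in>space M. X \<omega> = -1} = 1/2"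
  shows "distr M borel X = rademacher"
proof (rule measure_eqI)
  let ?P = "{\<omega>\<in>space M. X \<omega> = 1}" and ?N = "{\<omega>\<in>space M. X \<omega> = -1}"
  have "prob (?P \<union> ?N) = prob ?P + prob ?N"
    by (rule finite_measure_Union) auto
  then have "prob (?P \<union> ?N) = 1" using p by simp
  then have AE: "AE \<omega> in M. \<omega> \<in> ?P \<union> ?N" by (rule AE_prob_1)
  fix A assume "A \<in> sets (distr M borel X)"
  then have A [measurable]: "A \<in> sets borel" by simp
  have "emeasure (distr M borel X) A = (\<integral>\<^sup>+x. indicator A x \<partial>distr M borel X)" by simp
  also have "\<dots> = (\<integral>\<^sup>+\<omega>. indicator A (X \<omega>) \<partial>M)"
    by (rule nn_integral_distr) auto
  also have "\<dots> = (\<integral>\<^sup>+\<omega>. indicator A 1 * indicator ?P \<omega> + indicator A (-1) * indicator ?N \<omega> \<partial>M)"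
    by (rule nn_integral_cong_AE, use AE in eventually_elim) (auto simp: indicator_def)
  also have "\<dots> = indicator A 1 * emeasure M ?P + indicator A (-1) * emeasure M ?N"
    by (subst nn_integral_add) (auto simp: nn_integral_cmult)
  also have "\<dots> = (indicator A 1 + indicator A (-1)) / 2"
    unfolding emeasure_eq_measure p
    by (simp add: divide_ennreal_def distrib_right ennreal_divide_numeral[of 1, symmetric])
  also have "\<dots> = emeasure rademacher A"
    using nn_integral_rademacher[of "indicator A"] by simp
  finally show "emeasure (distr M borel X) A = emeasure rademacher A" .
qed simp

lemma (in prob_space) distr_eq_path_law:
  fixes E eps :: "nat \<Rightarrow> 'a \<Rightarrow> real"
  assumes ind: "indep_vars (\<lambda>_. borel) (\<lambda>j. case j of Inl k \<Rightarrow> E k | Inr k \<Rightarrow> eps k) UNIV"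
    and E: "\<And>k. distributed M lborel (E k) (exponential_density \<theta>)"
    and eps [measurable]: "\<And>k. eps k \<in> borel_measurable M"
    and "\<And>k. prob {\<omega>\<in>space M. eps k \<omega> = 1} = 1/2"
    and "\<And>k. prob {\<omega>\<in>space M. eps k \<omega> = -1} = 1/2"
  shows "(\<lambda>\<omega> k. (E k \<omega>, eps (Suc k) \<omega>)) \<in> measurable M (path_law \<theta>)"
    and "distr M (path_law \<theta>) (\<lambda>\<omega> k. (E k \<omega>, eps (Suc k) \<omega>)) = path_law \<theta>"
proof -
  define X where "X = (\<lambda>j. case j of Inl k \<Rightarrow> E k | Inr k \<Rightarrow> eps k)"
  \<comment> \<open>Waiting time \<open>k\<close> is grouped with jump \<open>Suc k\<close>, because
    \<open>cpp\<close> sums jumps from index one. The blocks are disjoint, so the pairs inherit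
    independence.\<close>
  define K where "K k = {Inl k, Inr (Suc k)}" for k :: nat
  have X: "indep_vars (\<lambda>_. borel) X UNIV" using ind by (simp add: X_def)
  have E_meas [measurable]: "E k \<in> borel_measurable M" for k
    using distributed_measurable[OF E[of k]] by simp
  have step: "distr M (borel \<Otimes>\<^sub>M borel) (\<lambda>\<omega>. (E k \<omega>, eps (Suc k) \<omega>)) = step_law \<theta>" for k
  proof -
    have "indep_var (PiM {Inl k} (\<lambda>_. borel)) (\<lambda>\<omega>. restrict (\<lambda>i. X i \<omega>) {Inl k})
        (PiM {Inr (Suc k)} (\<lambda>_. borel)) (\<lambda>\<omega>. restrict (\<lambda>i. X i \<omega>) {Inr (Suc k)})"
      by (rule indep_var_restrict[OF X]) auto
    then have "indep_var borel ((\<lambda>f. f (Inl k)) \<circ> (\<lambda>\<omega>. restrict (\<lambda>i. X i \<omega>) {Inl k}))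
        borel ((\<lambda>f. f (Inr (Suc k))) \<circ> (\<lambda>\<omega>. restrict (\<lambda>i. X i \<omega>) {Inr (Suc k)}))"
      by (rule indep_var_compose) measurable
    then have "indep_var borel (E k) borel (eps (Suc k))"
      by (simp add: comp_def X_def)
    moreover have "distr M borel (E k) = density lborel (exponential_density \<theta>)"
      using distributed_distr_eq_density[OF E[of k]] by (simp cong: distr_cong)
    moreover have "distr M borel (eps (Suc k)) = rademacher"
      by (intro distr_eq_rademacher assms)
    ultimately show ?thesis by (simp add: indep_var_distribution_eq step_law_def)
  qed
  have "indep_vars (\<lambda>k. PiM (K k) (\<lambda>_. borel)) (\<lambda>k \<omega>. restrict (\<lambda>i. X i \<omega>) (K k)) UNIV"
    by (rule indep_vars_restrict[OF X]) (auto simp: disjoint_family_on_def K_def)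
  then have "indep_vars (\<lambda>_. borel \<Otimes>\<^sub>M borel)
      (\<lambda>k \<omega>. (restrict (\<lambda>i. X i \<omega>) (K k) (Inl k), restrict (\<lambda>i. X i \<omega>) (K k) (Inr (Suc k)))) UNIV"
    by (rule indep_vars_compose2[where Y="\<lambda>k f. (f (Inl k), f (Inr (Suc k)))"]) (auto simp: K_def)
  then have pairs: "indep_vars (\<lambda>_. borel \<Otimes>\<^sub>M borel) (\<lambda>k \<omega>. (E k \<omega>, eps (Suc k) \<omega>)) UNIV"
    by (simp add: X_def K_def)
  have "(\<lambda>\<omega> k. (E k \<omega>, eps (Suc k) \<omega>)) \<in> measurable M (\<Pi>\<^sub>M k\<in>UNIV. borel \<Otimes>\<^sub>M borel)"
    by (rule measurable_abs_UNIV) measurable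
  then show "(\<lambda>\<omega> k. (E k \<omega>, eps (Suc k) \<omega>)) \<in> measurable M (path_law \<theta>)"
    by (simp cong: measurable_cong_sets add: sets_path_law)
  have "distr M (path_law \<theta>) (\<lambda>\<omega> k. (E k \<omega>, eps (Suc k) \<omega>))
     = distr M (\<Pi>\<^sub>M k\<in>UNIV. borel \<Otimes>\<^sub>M borel) (\<lambda>\<omega>. \<lambda>k\<in>UNIV. (E k \<omega>, eps (Suc k) \<omega>))"
    by (intro distr_cong sets_path_law) auto
  also have "\<dots> = (\<Pi>\<^sub>M k\<in>UNIV. distr M (borel \<Otimes>\<^sub>M borel) (\<lambda>\<omega>. (E k \<omega>, eps (Suc k) \<omega>)))"
    using pairs by (subst (asm) indep_vars_iff_distr_eq_PiM) auto
  also have "\<dots> = path_law \<theta>"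
    unfolding path_law_def step ..
  finally show "distr M (path_law \<theta>) (\<lambda>\<omega> k. (E k \<omega>, eps (Suc k) \<omega>)) = path_law \<theta>" .
qed

text \<open>Holds for every outcome, not only almost surely: the summation starts at index one,
  where \<open>Suc (k - Suc 0) = k\<close>.\<close>

lemma cpp_eq_path_cpp: "cpp E eps t \<omega> = path_cpp t (\<lambda>k. (E k \<omega>, eps (Suc k) \<omega>))"
  unfolding cpp_def by (intro sum.cong) (auto simp: poisson_count_def)

subsection \<open>Moments and characteristic functions\<close>

text \<open>Averaging \<open>(x + 1) ^ k\<close> and \<open>(x - 1) ^ k\<close> cancels every second
  term, so the recursion stays within polynomials in \<open>x\<close> and \<open>m\<close>. Sixth
  powers appear because the error bound involves the cube of a squared increment.\<close>

lemma walk_mean_moments: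
  "walk_mean m (\<lambda>y. y ^ 2) x = x ^ 2 + real m"
  "walk_mean m (\<lambda>y. y ^ 4) x = x ^ 4 + 6 * real m * x ^ 2 + 3 * real m ^ 2 - 2 * real m"
  "walk_mean m (\<lambda>y. y ^ 6) x = x ^ 6 + 15 * real m * x ^ 4 + (45 * real m ^ 2 - 30 * real m) * x ^ 2
     + 15 * real m ^ 3 - 30 * real m ^ 2 + 16 * real m"
proof (induction m arbitrary: x)
  case (Suc m)
  {
    case 1
    show ?case unfolding walk_mean.simps Suc.IH by (simp add: field_simps eval_nat_numeral)
  next
    case 2
    show ?case unfolding walk_mean.simps Suc.IH by (simp add: field_simps eval_nat_numeral)
  next
    case 3
    show ?case unfolding walk_mean.simps Suc.IH by (simp add: field_simps eval_nat_numeral)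
  }
qed simp_all

text \<open>The Stein-Chen identity for a Poisson variable \<open>N\<close>: the mean of
  \<open>N * f N\<close> is \<open>l\<close> times the mean of \<open>f (N + 1)\<close>. The weight
  of \<open>Suc m\<close> times \<open>Suc m\<close> is \<open>l\<close> times the weight of
  \<open>m\<close>, and the term at \<open>m = 0\<close> vanishes.\<close>

lemma poisson_weight_sums_shift:
  assumes "(\<lambda>m. poisson_weight l m * f (Suc m)) sums s"
  shows "(\<lambda>m. poisson_weight l m * (real m * f m)) sums (l * s)"
proof -
  have "poisson_weight l (Suc m) * (real (Suc m) * f (Suc m)) = l * (poisson_weight l m * f (Suc m))" for m
    by (simp add: poisson_weight_def divide_simps del: of_nat_Suc)
  then have "(\<lambda>m. poisson_weight l (Suc m) * (real (Suc m) * f (Suc m))) sums (l * s)"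
    using sums_mult[OF assms, of l] by (simp only:)
  then show ?thesis by (subst (asm) sums_Suc_iff) simp
qed

text \<open>The moment of order \<open>k + 1\<close> comes from the shift identity with
  \<open>f m = m ^ k\<close>; expanding \<open>(m + 1) ^ k\<close> leaves only moments of order at
  most \<open>k\<close>.\<close>

lemma poisson_weight_moments:
  "(\<lambda>m. poisson_weight l m * real m) sums l"
  "(\<lambda>m. poisson_weight l m * real m ^ 2) sums (l ^ 2 + l)"
  "(\<lambda>m. poisson_weight l m * real m ^ 3) sums (l ^ 3 + 3 * l ^ 2 + l)"
proof -
  show 1: "(\<lambda>m. poisson_weight l m * real m) sums l"
    using poisson_weight_sums_shift[of l "\<lambda>_. 1" 1] poisson_weight_sums[of l] by simp
  have "(\<lambda>m. poisson_weight l m * real (Suc m)) sums (l + 1)"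
    using sums_add[OF 1 poisson_weight_sums[of l]] by (simp add: algebra_simps)
  then show 2: "(\<lambda>m. poisson_weight l m * real m ^ 2) sums (l ^ 2 + l)"
    using poisson_weight_sums_shift[of l real "l + 1"] by (simp add: algebra_simps power2_eq_square)
  have "(\<lambda>m. poisson_weight l m * real (Suc m) ^ 2) sums ((l ^ 2 + l) + 2 * l + 1)"
    using sums_add[OF sums_add[OF 2 sums_mult[OF 1, of 2]] poisson_weight_sums[of l]]
    by (simp add: algebra_simps power2_eq_square)
  then show "(\<lambda>m. poisson_weight l m * real m ^ 3) sums (l ^ 3 + 3 * l ^ 2 + l)"
    using poisson_weight_sums_shift[of l "\<lambda>m. real m ^ 2" "(l ^ 2 + l) + 2 * l + 1"]
    by (simp add: algebra_simps eval_nat_numeral)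
qed

lemma expectation_path_cpp:
  assumes \<theta>: "\<theta> > 0" and t: "t \<ge> 0" and h: "\<And>y. 0 \<le> h y" and [measurable]: "h \<in> borel_measurable borel"
    and s: "(\<lambda>m. poisson_weight (\<theta> * t) m * walk_mean m h 0) sums s"
  shows "integrable (path_law \<theta>) (\<lambda>\<omega>. h (path_cpp t \<omega>))"
    and "(\<integral>\<omega>. h (path_cpp t \<omega>) \<partial>path_law \<theta>) = s"
proof -
  have nn: "0 \<le> poisson_weight (\<theta> * t) m * walk_mean m h 0" for m
    using \<theta> t h by (intro mult_nonneg_nonneg poisson_weight_nonneg walk_mean_nonneg) auto
  have "0 \<le> s" using sums_le[OF _ sums_zero s] nn by simp
  moreover have "(\<integral>\<^sup>+\<omega>. ennreal (h (path_cpp t \<omega>)) \<partial>path_law \<theta>) = ennreal s"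
    using nn_integral_path_cpp[OF \<theta> t h assms(4)] suminf_ennreal_eq[OF nn s] by simp
  ultimately have "integrable (path_law \<theta>) (\<lambda>\<omega>. h (path_cpp t \<omega>)) \<and> (\<integral>\<omega>. h (path_cpp t \<omega>) \<partial>path_law \<theta>) = s"
    using h by (subst (asm) nn_integral_eq_integrable) auto
  then show "integrable (path_law \<theta>) (\<lambda>\<omega>. h (path_cpp t \<omega>))"
    "(\<integral>\<omega>. h (path_cpp t \<omega>) \<partial>path_law \<theta>) = s" by auto
qed

text \<open>At \<open>x = 0\<close> the walk moments are polynomials of degree at most three in
  \<open>m\<close>, so averaging needs only the first three Poisson moments. The multipliers 3, -2
  and 15, -30, 16 in the proof are the coefficients of these polynomials.\<close>

lemma path_cpp_moments:
  assumes \<theta>: "\<theta> > 0" and t: "t \<ge> 0"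
  defines "l \<equiv> \<theta> * t"
  shows "integrable (path_law \<theta>) (\<lambda>\<omega>. path_cpp t \<omega> ^ 2)"
    and "(\<integral>\<omega>. path_cpp t \<omega> ^ 2 \<partial>path_law \<theta>) = l"
    and "integrable (path_law \<theta>) (\<lambda>\<omega>. path_cpp t \<omega> ^ 4)"
    and "(\<integral>\<omega>. path_cpp t \<omega> ^ 4 \<partial>path_law \<theta>) = 3 * l ^ 2 + l"
    and "integrable (path_law \<theta>) (\<lambda>\<omega>. path_cpp t \<omega> ^ 6)"
    and "(\<integral>\<omega>. path_cpp t \<omega> ^ 6 \<partial>path_law \<theta>) = 15 * l ^ 3 + 15 * l ^ 2 + l"
proof -
  note m = poisson_weight_moments[of l]
  have "(\<lambda>k. poisson_weight l k * walk_mean k (\<lambda>y. y ^ 2) 0) sums l"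
    using m(1) by (simp add: walk_mean_moments)
  from expectation_path_cpp[OF \<theta> t _ _ this[unfolded l_def]]
  show "integrable (path_law \<theta>) (\<lambda>\<omega>. path_cpp t \<omega> ^ 2)" "(\<integral>\<omega>. path_cpp t \<omega> ^ 2 \<partial>path_law \<theta>) = l"
    by (auto simp: l_def)
  have "(\<lambda>k. 3 * (poisson_weight l k * real k ^ 2) - 2 * (poisson_weight l k * real k)) sums (3 * (l ^ 2 + l) - 2 * l)"
    by (intro sums_diff sums_mult m)
  then have "(\<lambda>k. poisson_weight l k * walk_mean k (\<lambda>y. y ^ 4) 0) sums (3 * l ^ 2 + l)"
    by (simp add: walk_mean_moments algebra_simps)
  from expectation_path_cpp[OF \<theta> t _ _ this[unfolded l_def]]
  show "integrable (path_law \<theta>) (\<lambda>\<omega>. path_cpp t \<omega> ^ 4)" "(\<integral>\<omega>. path_cpp t \<omega> ^ 4 \<partial>path_law \<theta>) = 3 * l ^ 2 + l"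
    by (auto simp: l_def)
  have "(\<lambda>k. 15 * (poisson_weight l k * real k ^ 3) - 30 * (poisson_weight l k * real k ^ 2)
      + 16 * (poisson_weight l k * real k)) sums (15 * (l ^ 3 + 3 * l ^ 2 + l) - 30 * (l ^ 2 + l) + 16 * l)"
    by (intro sums_diff sums_add sums_mult m)
  then have "(\<lambda>k. poisson_weight l k * walk_mean k (\<lambda>y. y ^ 6) 0) sums (15 * l ^ 3 + 15 * l ^ 2 + l)"
    by (simp add: walk_mean_moments algebra_simps)
  from expectation_path_cpp[OF \<theta> t _ _ this[unfolded l_def]]
  show "integrable (path_law \<theta>) (\<lambda>\<omega>. path_cpp t \<omega> ^ 6)"
    "(\<integral>\<omega>. path_cpp t \<omega> ^ 6 \<partial>path_law \<theta>) = 15 * l ^ 3 + 15 * l ^ 2 + l"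
    by (auto simp: l_def zero_le_even_power)
qed

section \<open>Sums of centred squared increments and their characteristic function\<close>

definition sq_dev_sum :: "real \<Rightarrow> real \<Rightarrow> nat \<Rightarrow> (nat \<Rightarrow> real \<times> real) \<Rightarrow> real" where
  "sq_dev_sum c \<Delta> n \<omega> =
     (\<Sum>i<n. (path_cpp (real (Suc i) * \<Delta>) \<omega> - path_cpp (real i * \<Delta>) \<omega>)\<^sup>2 - c)"

lemma measurable_sq_dev_sum [measurable]: "sq_dev_sum c \<Delta> n \<in> borel_measurable (path_law \<theta>)"
  unfolding sq_dev_sum_def[abs_def] by measurable

text \<open>Seen from time \<open>\<Delta>\<close> the time grid looks the same again, so each later
  increment of the path is the increment of the restarted path one grid cell earlier.\<close>

lemma AE_sq_dev_sum_Suc: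
  assumes \<theta>: "\<theta> > 0" and \<Delta>: "\<Delta> \<ge> 0"
  shows "AE \<omega> in path_law \<theta>. sq_dev_sum c \<Delta> (Suc n) \<omega> =
           ((path_cpp \<Delta> \<omega>)\<^sup>2 - c) + sq_dev_sum c \<Delta> n (restart (path_count \<Delta> \<omega>) \<Delta> \<omega>)"
proof -
  \<comment> \<open>The countably many grid times share one exceptional null set.\<close>
  have "AE \<omega> in path_law \<theta>. \<forall>i. \<exists>m. arrivals_at m (real i * \<Delta>) \<omega>"
    unfolding AE_all_countable using AE_arrivals_at[OF \<theta>] \<Delta> by simp
  then show ?thesis
  proof eventually_elim
    fix \<omega> assume *: "\<forall>i. \<exists>m. arrivals_at m (real i * \<Delta>) \<omega>"
    obtain m where m: "arrivals_at m \<Delta> \<omega>" using *[rule_format, of 1] by auto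
    \<comment> \<open>Positivity of the first waiting time rules out a jump at time zero, so the
      process starts at 0.\<close>
    have "arrivals_at 0 0 \<omega>" using m by (simp add: arrivals_at_def arrival_def positive_path_def)
    then have 0: "path_cpp 0 \<omega> = 0" by (simp add: path_cpp_eq)
    have S: "path_cpp (real (Suc i) * \<Delta>) \<omega> = path_cpp \<Delta> \<omega> + path_cpp (real i * \<Delta>) (restart m \<Delta> \<omega>)" for i
    proof -
      obtain m' where "arrivals_at m' (real (Suc i) * \<Delta>) \<omega>" using * by blast
      moreover have eq: "real (Suc i) * \<Delta> = \<Delta> + real i * \<Delta>" by (simp add: algebra_simps)
      ultimately show ?thesis unfolding eq using \<Delta> by (intro path_cpp_add[OF m]) auto
    qed
    have incr: "path_cpp (real (Suc (Suc i)) * \<Delta>) \<omega> - path_cpp (real (Suc i) * \<Delta>) \<omega>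
      = path_cpp (real (Suc i) * \<Delta>) (restart m \<Delta> \<omega>) - path_cpp (real i * \<Delta>) (restart m \<Delta> \<omega>)" for i
      unfolding S by simp
    have "sq_dev_sum c \<Delta> (Suc n) \<omega> = ((path_cpp (real (Suc 0) * \<Delta>) \<omega> - path_cpp (real 0 * \<Delta>) \<omega>)\<^sup>2 - c)
       + (\<Sum>i<n. (path_cpp (real (Suc (Suc i)) * \<Delta>) \<omega> - path_cpp (real (Suc i) * \<Delta>) \<omega>)\<^sup>2 - c)"
      unfolding sq_dev_sum_def by (rule sum.lessThan_Suc_shift)
    also have "\<dots> = ((path_cpp \<Delta> \<omega>)\<^sup>2 - c) + sq_dev_sum c \<Delta> n (restart m \<Delta> \<omega>)"
      unfolding sq_dev_sum_def incr by (simp add: 0)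
    finally show "sq_dev_sum c \<Delta> (Suc n) \<omega> =
           ((path_cpp \<Delta> \<omega>)\<^sup>2 - c) + sq_dev_sum c \<Delta> n (restart (path_count \<Delta> \<omega>) \<Delta> \<omega>)"
      by (simp add: poisson_count_eq[OF m])
  qed
qed

text \<open>The first squared increment is independent of the restarted path, which again has law
  \<open>path_law \<theta>\<close>; so each induction step contributes one factor.\<close>

lemma char_sq_dev_sum:
  assumes \<theta>: "\<theta> > 0" and \<Delta>: "\<Delta> \<ge> 0"
  shows "char (distr (path_law \<theta>) borel (sq_dev_sum c \<Delta> n)) u
       = char (distr (path_law \<theta>) borel (\<lambda>\<omega>. (path_cpp \<Delta> \<omega>)\<^sup>2 - c)) u ^ n"
proof (induction n)
  case 0
  interpret Q: prob_space "path_law \<theta>" by (rule prob_space_path_law[OF \<theta>])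
  show ?case
    by (simp add: sq_dev_sum_def[abs_def] char_def integral_distr Q.prob_space[simplified] del: Q.distr_const)
next
  case (Suc n)
  interpret Q: prob_space "path_law \<theta>" by (rule prob_space_path_law[OF \<theta>])
  let ?R = "\<lambda>\<omega>. restart (path_count \<Delta> \<omega>) \<Delta> \<omega>"
  have "distr (path_law \<theta>) borel (sq_dev_sum c \<Delta> (Suc n))
     = distr (path_law \<theta>) borel (\<lambda>\<omega>. ((path_cpp \<Delta> \<omega>)\<^sup>2 - c) + sq_dev_sum c \<Delta> n (?R \<omega>))"
    by (intro distr_cong_AE AE_sq_dev_sum_Suc[OF \<theta> \<Delta>] refl) measurable
  also have "char \<dots> u = char (distr (path_law \<theta>) borel (\<lambda>\<omega>. (path_cpp \<Delta> \<omega>)\<^sup>2 - c)) u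
      * char (distr (path_law \<theta>) borel (\<lambda>\<omega>. sq_dev_sum c \<Delta> n (?R \<omega>))) u"
    by (intro Q.char_distr_add indep_var_path_cpp_restart[OF \<theta> \<Delta>, of "\<lambda>x. x\<^sup>2 - c"]) measurable
  also have "distr (path_law \<theta>) borel (\<lambda>\<omega>. sq_dev_sum c \<Delta> n (?R \<omega>))
      = distr (distr (path_law \<theta>) (path_law \<theta>) ?R) borel (sq_dev_sum c \<Delta> n)"
    by (subst distr_distr) (auto simp: comp_def)
  also have "\<dots> = distr (path_law \<theta>) borel (sq_dev_sum c \<Delta> n)"
    by (simp only: distr_restart[OF \<theta> \<Delta>])
  finally show ?case using Suc.IH by simp
qed

text \<open>Taylor expansion for a centred variable of variance \<open>l + 2 * l\<^sup>2\<close>.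
  Its third absolute moment is at most the sixth moment of \<open>path_cpp\<close> plus
  \<open>l ^ 3\<close>, whence the leading coefficient \<open>16 = 15 + 1\<close>.\<close>

lemma char_sq_dev_approx:
  assumes \<theta>: "\<theta> > 0" and \<Delta>: "\<Delta> \<ge> 0"
  defines "l \<equiv> \<theta> * \<Delta>"
  shows "cmod (char (distr (path_law \<theta>) borel (\<lambda>\<omega>. (path_cpp \<Delta> \<omega>)\<^sup>2 - l)) v - (1 - v\<^sup>2 * (l + 2 * l\<^sup>2) / 2))
       \<le> \<bar>v\<bar> ^ 3 / 6 * (16 * l ^ 3 + 15 * l ^ 2 + l)"
proof -
  interpret Q: prob_space "path_law \<theta>" by (rule prob_space_path_law[OF \<theta>])
  have l: "l \<ge> 0" using \<theta> \<Delta> by (simp add: l_def)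
  note mom = path_cpp_moments[OF \<theta> \<Delta>, folded l_def]
  let ?Y = "\<lambda>\<omega>. (path_cpp \<Delta> \<omega>)\<^sup>2 - l"
  have Y2: "(?Y \<omega>)\<^sup>2 = path_cpp \<Delta> \<omega> ^ 4 - 2 * l * (path_cpp \<Delta> \<omega>)\<^sup>2 + l\<^sup>2" for \<omega>
    by (simp add: power2_diff flip: power_mult)
  have EY: "Q.expectation ?Y = 0" using mom(1,2) by (simp add: Q.prob_space[simplified])
  have "Q.variance ?Y = Q.expectation (\<lambda>\<omega>. path_cpp \<Delta> \<omega> ^ 4 - 2 * l * (path_cpp \<Delta> \<omega>)\<^sup>2 + l\<^sup>2)"
    by (simp only: EY diff_zero Y2)
  also have "\<dots> = 3 * l\<^sup>2 + l - 2 * l * l + l\<^sup>2"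
    using mom by (simp add: Q.prob_space[simplified])
  finally have VY: "Q.variance ?Y = l + 2 * l\<^sup>2" by (simp add: power2_eq_square)
  \<comment> \<open>The square and \<open>l\<close> are both nonnegative, so their distance is at
    most the larger of them.\<close>
  have Y3: "\<bar>?Y \<omega>\<bar> ^ 3 \<le> path_cpp \<Delta> \<omega> ^ 6 + l ^ 3" for \<omega>
  proof -
    let ?a = "(path_cpp \<Delta> \<omega>)\<^sup>2"
    have "\<bar>?Y \<omega>\<bar> ^ 3 \<le> (max ?a l) ^ 3"
      using l by (intro power_mono) (auto simp: abs_if max_def)
    also have "\<dots> \<le> ?a ^ 3 + l ^ 3" using l by (auto simp: max_def)
    finally show ?thesis by (simp flip: power_mult)
  qed
  have "cmod (char (distr (path_law \<theta>) borel ?Y) v - (1 - v\<^sup>2 * (l + 2 * l\<^sup>2) / 2))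
     \<le> (v\<^sup>2 / 6) * Q.expectation (\<lambda>\<omega>. min (6 * (?Y \<omega>)\<^sup>2) (\<bar>v\<bar> * \<bar>?Y \<omega>\<bar> ^ 3))"
    using mom EY VY by (intro Q.char_approx3') (auto simp: Y2)
  also have "Q.expectation (\<lambda>\<omega>. min (6 * (?Y \<omega>)\<^sup>2) (\<bar>v\<bar> * \<bar>?Y \<omega>\<bar> ^ 3))
     \<le> Q.expectation (\<lambda>\<omega>. \<bar>v\<bar> * (path_cpp \<Delta> \<omega> ^ 6 + l ^ 3))"
  proof (rule integral_mono')
    show "integrable (path_law \<theta>) (\<lambda>\<omega>. \<bar>v\<bar> * (path_cpp \<Delta> \<omega> ^ 6 + l ^ 3))"
      using mom by simp
    show "min (6 * (?Y \<omega>)\<^sup>2) (\<bar>v\<bar> * \<bar>?Y \<omega>\<bar> ^ 3) \<le> \<bar>v\<bar> * (path_cpp \<Delta> \<omega> ^ 6 + l ^ 3)" for \<omega>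
      using Y3[of \<omega>] by (intro min.coboundedI2 mult_left_mono) auto
    show "0 \<le> \<bar>v\<bar> * (path_cpp \<Delta> \<omega> ^ 6 + l ^ 3)" for \<omega>
      using l by (auto intro!: mult_nonneg_nonneg add_nonneg_nonneg zero_le_even_power)
  qed
  also have "Q.expectation (\<lambda>\<omega>. \<bar>v\<bar> * (path_cpp \<Delta> \<omega> ^ 6 + l ^ 3)) = \<bar>v\<bar> * (16 * l ^ 3 + 15 * l ^ 2 + l)"
    using mom by (simp add: Q.prob_space[simplified])
  finally show ?thesis
    by (simp add: mult_left_mono power3_eq_cube power2_eq_square abs_if split: if_splits)
qed

subsection \<open>The normal limit\<close>

text \<open>The upper half uses \<open>exp (- q) \<le> 1 / (1 + q)\<close> and
  \<open>(1 - q + q\<^sup>2) * (1 + q) = 1 + q ^ 3\<close>. The bound serves to replace the Taylor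
  polynomial \<open>1 - q\<close> by a factor whose powers are Gaussian.\<close>

lemma exp_minus_bound:
  assumes "0 \<le> q" shows "\<bar>exp (- q) - (1 - q)\<bar> \<le> (q::real)\<^sup>2"
proof -
  have 1: "1 + q \<le> exp q" "1 - q \<le> exp (- q)"
    using exp_ge_add_one_self[of q] exp_ge_add_one_self[of "- q"] by auto
  have "exp (- q) \<le> 1 / (1 + q)"
    using 1 assms by (simp add: exp_minus inverse_eq_divide frac_le)
  also have "\<dots> \<le> 1 - q + q\<^sup>2"
  proof -
    have "(1 - q + q\<^sup>2) * (1 + q) = 1 + q ^ 3" by (simp add: algebra_simps eval_nat_numeral)
    then have "1 \<le> (1 - q + q\<^sup>2) * (1 + q)" using assms by simp
    then show ?thesis using assms by (subst pos_divide_le_eq) auto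
  qed
  finally show ?thesis using 1 by simp
qed

lemma (in prob_space) char_distr_affine:
  assumes [measurable]: "V \<in> borel_measurable M"
  shows "char (distr M borel (\<lambda>\<omega>. (V \<omega> + c) / s)) u = iexp (u * (c / s)) * char (distr M borel V) (u / s)"
proof -
  have "char (distr M borel (\<lambda>\<omega>. (V \<omega> + c) / s)) u = (\<integral>\<omega>. iexp (u * ((V \<omega> + c) / s)) \<partial>M)"
    unfolding char_def by (subst integral_distr) auto
  also have "\<dots> = (\<integral>\<omega>. iexp (u * (c / s)) * iexp (u / s * V \<omega>) \<partial>M)"
    by (intro Bochner_Integration.integral_cong refl)
       (simp add: exp_add[symmetric] add_divide_distrib algebra_simps)
  also have "\<dots> = iexp (u * (c / s)) * (\<integral>\<omega>. iexp (u / s * V \<omega>) \<partial>M)"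
    by (rule integral_mult_right_zero)
  also have "(\<integral>\<omega>. iexp (u / s * V \<omega>) \<partial>M) = char (distr M borel V) (u / s)"
    unfolding char_def by (subst integral_distr) auto
  finally show ?thesis .
qed

section \<open>The normalised error and its distance from the Gaussian characteristic
  function\<close>

abbreviation path_xi :: "real \<Rightarrow> real \<Rightarrow> real \<Rightarrow> (nat \<Rightarrow> real \<times> real) \<Rightarrow> real" where
  "path_xi \<equiv> qv_xi (\<lambda>k \<omega>. fst (\<omega> k)) (\<lambda>k \<omega>. snd (\<omega> (k - Suc 0)))"

text \<open>\<open>qv_scale\<close> is \<open>T\<close> times the normalisation in \<open>qv_xi\<close>; \<open>qv_bias\<close> stems from the fractional part
  of \<open>T / \<Delta>\<close>.\<close>

definition qv_scale :: "real \<Rightarrow> real \<Rightarrow> real \<Rightarrow> real" where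
  "qv_scale \<theta> T \<Delta> = sqrt (T / \<Delta> * (\<theta> * \<Delta> + 2 * (\<theta> * \<Delta>)\<^sup>2))"

definition qv_bias :: "real \<Rightarrow> real \<Rightarrow> real \<Rightarrow> real" where
  "qv_bias \<theta> T \<Delta> = real (nat \<lfloor>T / \<Delta>\<rfloor>) * (\<theta> * \<Delta>) - \<theta> * T"

lemma qv_scale_pos: "\<theta> > 0 \<Longrightarrow> T > 0 \<Longrightarrow> \<Delta> > 0 \<Longrightarrow> qv_scale \<theta> T \<Delta> > 0"
  by (simp add: qv_scale_def add_pos_pos)

lemma path_xi_eq:
  assumes "\<theta> > 0" "T > 0" "\<Delta> > 0"
  shows "path_xi \<theta> T \<Delta> \<omega> =
    (sq_dev_sum (\<theta> * \<Delta>) \<Delta> (nat \<lfloor>T / \<Delta>\<rfloor>) \<omega> + qv_bias \<theta> T \<Delta>) / qv_scale \<theta> T \<Delta>"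
proof -
  let ?n = "nat \<lfloor>T / \<Delta>\<rfloor>"
  \<comment> \<open>Since \<open>\<theta> * \<Delta> + 2 * (\<theta> * \<Delta>)\<^sup>2\<close> is
    the variance of one squared increment, the inverse informations add up to
    \<open>T / \<Delta>\<close> such variances divided by \<open>T\<^sup>2\<close>.\<close>
  have *: "inverse (fisher_0 \<theta> T) + inverse (fisher_inf \<theta> T \<Delta>) = T / \<Delta> * (\<theta> * \<Delta> + 2 * (\<theta> * \<Delta>)\<^sup>2) / T\<^sup>2"
    using assms by (simp add: fisher_0_def fisher_inf_def field_simps power2_eq_square)
  have d: "sqrt (inverse (fisher_0 \<theta> T) + inverse (fisher_inf \<theta> T \<Delta>)) = qv_scale \<theta> T \<Delta> / T"
    unfolding * qv_scale_def real_sqrt_divide[of _ "T\<^sup>2"] using assms by simp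
  have "(\<Sum>i\<in>{1..?n}. (path_cpp (real i * \<Delta>) \<omega> - path_cpp ((real i - 1) * \<Delta>) \<omega>)\<^sup>2)
      = (\<Sum>i<?n. (path_cpp (real (Suc i) * \<Delta>) \<omega> - path_cpp (real i * \<Delta>) \<omega>)\<^sup>2)"
    by (rule sum.reindex_bij_witness[of _ Suc "\<lambda>i. i - 1"]) auto
  also have "\<dots> = sq_dev_sum (\<theta> * \<Delta>) \<Delta> ?n \<omega> + real ?n * (\<theta> * \<Delta>)"
    by (simp add: sq_dev_sum_def sum_subtractf)
  finally have S: "(\<Sum>i\<in>{1..?n}. (path_cpp (real i * \<Delta>) \<omega> - path_cpp ((real i - 1) * \<Delta>) \<omega>)\<^sup>2)
      = sq_dev_sum (\<theta> * \<Delta>) \<Delta> ?n \<omega> + real ?n * (\<theta> * \<Delta>)" .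
  show ?thesis
    unfolding qv_xi_def qv_est_def d S qv_bias_def
    using assms qv_scale_pos[of \<theta> T \<Delta>] by (simp add: field_simps)
qed

text \<open>Uniformity in \<open>l\<close> comes from two lower bounds for
  \<open>sqrt (l + 2 * l\<^sup>2)\<close>: \<open>sqrt l\<close>, which matters for small
  \<open>l\<close>, and \<open>l\<close>, which matters for large \<open>l\<close>.\<close>

lemma third_moment_ratio:
  assumes l: "l > 0" and r: "r > 0"
  defines "s \<equiv> sqrt (r * (l + 2 * l\<^sup>2))"
  shows "r * (16 * l ^ 3 + 15 * l ^ 2 + l) / s ^ 3 \<le> 1 / sqrt (r * l) + 13 / sqrt r"
proof -
  define a where "a = l + 2 * l\<^sup>2"
  have a: "a > 0" using l by (simp add: a_def add_pos_pos)
  have s: "s = sqrt r * sqrt a" by (simp add: s_def a_def real_sqrt_mult)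
  have s3: "s ^ 3 = r * a * (sqrt r * sqrt a)"
    unfolding s using r a by (simp add: power3_eq_cube mult_ac)
  have la: "sqrt l \<le> sqrt a" using l by (simp add: a_def)
  have "l\<^sup>2 \<le> a" unfolding a_def using l zero_le_power2[of l] by linarith
  then have "sqrt (l\<^sup>2) \<le> sqrt a" by (rule real_sqrt_le_mono)
  then have la': "l \<le> sqrt a" using l by simp
  \<comment> \<open>The factor 13 matches the quadratic coefficient, \<open>13 + 2 = 15\<close>; the
    cubic coefficient on the right is then 26.\<close>
  have "16 * l ^ 3 + 15 * l ^ 2 + l \<le> (1 + 13 * l) * a"
    using l by (simp add: a_def algebra_simps eval_nat_numeral)
  then have "r * (16 * l ^ 3 + 15 * l ^ 2 + l) / s ^ 3 \<le> r * ((1 + 13 * l) * a) / s ^ 3"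
    using r a unfolding s3 by (intro divide_right_mono mult_left_mono) auto
  also have "\<dots> = (1 + 13 * l) / (sqrt r * sqrt a)"
    unfolding s3 using r a by simp
  also have "\<dots> = 1 / (sqrt r * sqrt a) + 13 * l / (sqrt r * sqrt a)"
    by (simp add: add_divide_distrib)
  also have "\<dots> \<le> 1 / (sqrt r * sqrt l) + 13 * sqrt a / (sqrt r * sqrt a)"
    using r a l la la' by (intro add_mono divide_left_mono divide_right_mono mult_left_mono) auto
  also have "\<dots> = 1 / sqrt (r * l) + 13 / sqrt r"
    using a by (simp add: real_sqrt_mult)
  finally show ?thesis .
qed

text \<open>On the closed unit disc, \<open>n\<close>-th powers differ by at most \<open>n\<close>
  times the difference of the bases, so it suffices to compare one factor with
  \<open>exp (- q)\<close>. The bias enters only as a phase.\<close>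

lemma char_path_xi_approx:
  assumes \<theta>: "\<theta> > 0" and T: "T > 0" and \<Delta>: "\<Delta> > 0"
  defines "r \<equiv> T / \<Delta>"
  shows "cmod (char (distr (path_law \<theta>) borel (path_xi \<theta> T \<Delta>)) u
            - iexp (u * (qv_bias \<theta> T \<Delta> / qv_scale \<theta> T \<Delta>)) * of_real (exp (- (u\<^sup>2 / (2 * r))) ^ nat \<lfloor>r\<rfloor>))
       \<le> \<bar>u\<bar> ^ 3 / 6 * (1 / sqrt (\<theta> * T) + 13 / sqrt r) + u ^ 4 / 4 / r"
proof -
  interpret Q: prob_space "path_law \<theta>" by (rule prob_space_path_law[OF \<theta>])
  define l where "l = \<theta> * \<Delta>"
  define s where "s = qv_scale \<theta> T \<Delta>"
  define n where "n = nat \<lfloor>r\<rfloor>"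
  \<comment> \<open>Half the variance of one summand times \<open>(u / s)\<^sup>2\<close>. The scale
    contains \<open>r\<close>, not its integer part \<open>n\<close>, so \<open>n * q\<close> equals
    \<open>u\<^sup>2 / 2\<close> only up to the factor \<open>n / r\<close>.\<close>
  define q where "q = u\<^sup>2 / (2 * r)"
  let ?c = "iexp (u * (qv_bias \<theta> T \<Delta> / s))"
  have l: "l > 0" and r: "r > 0" and s: "s > 0" using assms qv_scale_pos by (auto simp: l_def s_def)
  have n: "real n \<le> r" using r by (simp add: n_def)
  have s_eq: "s = sqrt (r * (l + 2 * l\<^sup>2))" by (simp add: s_def qv_scale_def l_def r_def)
  have lpos: "l + 2 * l\<^sup>2 > 0" using l by (simp add: add_pos_pos)
  have s2: "s\<^sup>2 = r * (l + 2 * l\<^sup>2)" unfolding s_eq using r lpos by simp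
  have q: "(u / s)\<^sup>2 * (l + 2 * l\<^sup>2) / 2 = q"
    unfolding power_divide s2 q_def using lpos r by simp
  have q0: "0 \<le> q" using r by (simp add: q_def)
  define \<phi> where "\<phi> = char (distr (path_law \<theta>) borel (\<lambda>\<omega>. (path_cpp \<Delta> \<omega>)\<^sup>2 - l)) (u / s)"
  interpret Y: real_distribution "distr (path_law \<theta>) borel (\<lambda>\<omega>. (path_cpp \<Delta> \<omega>)\<^sup>2 - l)"
    by (rule Q.real_distribution_distr) measurable
  have \<phi>1: "cmod \<phi> \<le> 1" unfolding \<phi>_def by (rule Y.cmod_char_le_1)
  have "distr (path_law \<theta>) borel (path_xi \<theta> T \<Delta>)
     = distr (path_law \<theta>) borel (\<lambda>\<omega>. (sq_dev_sum l \<Delta> n \<omega> + qv_bias \<theta> T \<Delta>) / s)"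
    by (simp add: path_xi_eq[OF \<theta> T \<Delta>] l_def n_def r_def s_def cong: distr_cong)
  then have "char (distr (path_law \<theta>) borel (path_xi \<theta> T \<Delta>)) u = ?c * \<phi> ^ n"
    using \<Delta> by (simp only: Q.char_distr_affine[OF measurable_sq_dev_sum] char_sq_dev_sum[OF \<theta> less_imp_le[OF \<Delta>]] \<phi>_def)
  then have "cmod (char (distr (path_law \<theta>) borel (path_xi \<theta> T \<Delta>)) u - ?c * of_real (exp (- q) ^ n))
      = cmod (\<phi> ^ n - of_real (exp (- q)) ^ n)"
    by (simp add: norm_mult right_diff_distrib[symmetric] del: of_real_mult of_real_divide)
  also have "\<dots> \<le> real n * cmod (\<phi> - of_real (exp (- q)))"
    using q0 \<phi>1 by (intro norm_power_diff) auto
  also have "\<dots> \<le> r * (\<bar>u / s\<bar> ^ 3 / 6 * (16 * l ^ 3 + 15 * l ^ 2 + l) + q\<^sup>2)"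
  proof (rule mult_mono[OF n])
    \<comment> \<open>The error for one factor is the Taylor remainder plus the cost
      \<open>q\<^sup>2\<close> of passing from \<open>1 - q\<close> to
      \<open>exp (- q)\<close>.\<close>
    have "cmod (\<phi> - of_real (1 - q)) \<le> \<bar>u / s\<bar> ^ 3 / 6 * (16 * l ^ 3 + 15 * l ^ 2 + l)"
      using char_sq_dev_approx[OF \<theta> less_imp_le[OF \<Delta>], of "u / s", folded l_def]
      unfolding q \<phi>_def of_real_diff by simp
    moreover have "cmod (of_real (1 - q) - of_real (exp (- q))) \<le> q\<^sup>2"
      using exp_minus_bound[OF q0] by (simp add: abs_minus_commute del: of_real_diff flip: of_real_diff)
    ultimately show "cmod (\<phi> - of_real (exp (- q))) \<le> \<bar>u / s\<bar> ^ 3 / 6 * (16 * l ^ 3 + 15 * l ^ 2 + l) + q\<^sup>2"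
      using norm_triangle_ineq[of "\<phi> - of_real (1 - q)" "of_real (1 - q) - of_real (exp (- q))"] by simp
  qed (use r in auto)
  also have "\<dots> = \<bar>u\<bar> ^ 3 / 6 * (r * (16 * l ^ 3 + 15 * l ^ 2 + l) / s ^ 3) + r * q\<^sup>2"
    using s by (simp add: power_divide field_simps)
  also have "\<dots> \<le> \<bar>u\<bar> ^ 3 / 6 * (1 / sqrt (r * l) + 13 / sqrt r) + r * q\<^sup>2"
    using third_moment_ratio[OF l r] unfolding s_eq by (intro add_right_mono mult_left_mono) auto
  also have "r * q\<^sup>2 = u ^ 4 / 4 / r"
    using r by (simp add: q_def power_divide power2_eq_square field_simps eval_nat_numeral)
  also have "r * l = \<theta> * T" using \<Delta> by (simp add: r_def l_def)
  finally show ?thesis by (simp only: q_def n_def s_def)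
qed

text \<open>Cutting off the fractional part of \<open>T / \<Delta>\<close> loses at most the mean
  \<open>l\<close> of one squared increment, while the quadratic part of the variance alone makes
  the scale at least \<open>sqrt r * l\<close>.\<close>

lemma qv_bias_bound:
  assumes \<theta>: "\<theta> > 0" and T: "T > 0" and \<Delta>: "\<Delta> > 0"
  shows "\<bar>qv_bias \<theta> T \<Delta> / qv_scale \<theta> T \<Delta>\<bar> \<le> 1 / sqrt (T / \<Delta>)"
proof -
  define l where "l = \<theta> * \<Delta>"
  define r where "r = T / \<Delta>"
  have l: "l > 0" and r: "r > 0" using assms by (auto simp: l_def r_def)
  have "qv_bias \<theta> T \<Delta> = (real (nat \<lfloor>r\<rfloor>) - r) * l"
    using \<Delta> by (simp add: qv_bias_def l_def r_def field_simps)
  moreover have "\<bar>real (nat \<lfloor>r\<rfloor>) - r\<bar> \<le> 1" using r by linarith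
  ultimately have b: "\<bar>qv_bias \<theta> T \<Delta>\<bar> \<le> l"
    using l by (simp add: abs_mult mult_left_le_one_le)
  have "sqrt (r * l\<^sup>2) \<le> sqrt (r * (l + 2 * l\<^sup>2))"
    using r l by (intro real_sqrt_le_mono mult_left_mono) auto
  moreover have "sqrt (r * l\<^sup>2) = sqrt r * l" using l by (simp add: real_sqrt_mult)
  ultimately have s: "sqrt r * l \<le> qv_scale \<theta> T \<Delta>"
    by (simp only: qv_scale_def l_def r_def)
  have "\<bar>qv_bias \<theta> T \<Delta> / qv_scale \<theta> T \<Delta>\<bar> = \<bar>qv_bias \<theta> T \<Delta>\<bar> / qv_scale \<theta> T \<Delta>"
    using qv_scale_pos[OF assms] by simp
  also have "\<dots> \<le> l / (sqrt r * l)"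
    using b s l r by (intro frac_le) auto
  finally show ?thesis using l by (simp add: r_def)
qed

section \<open>Passage to the limit\<close>

lemma floor_div_self_tendsto: "((\<lambda>r. real (nat \<lfloor>r\<rfloor>) / r) \<longlongrightarrow> 1) at_top"
proof (rule tendsto_sandwich)
  show "\<forall>\<^sub>F r in at_top. 1 - 1 / r \<le> real (nat \<lfloor>r\<rfloor>) / r"
    using eventually_gt_at_top[of 0]
  proof eventually_elim
    fix r :: real assume "0 < r"
    then have "r - 1 \<le> real (nat \<lfloor>r\<rfloor>)" by linarith
    then have "(r - 1) / r \<le> real (nat \<lfloor>r\<rfloor>) / r" using \<open>0 < r\<close> by (intro divide_right_mono) auto
    then show "1 - 1 / r \<le> real (nat \<lfloor>r\<rfloor>) / r" using \<open>0 < r\<close> by (simp add: diff_divide_distrib)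
  qed
  show "\<forall>\<^sub>F r in at_top. real (nat \<lfloor>r\<rfloor>) / r \<le> 1"
    using eventually_gt_at_top[of 0] by eventually_elim simp
  show "((\<lambda>r::real. 1 - 1 / r) \<longlongrightarrow> 1) at_top" by real_asymp
qed simp

text \<open>The explicit error vanishes because both \<open>\<theta> * T\<close> and
  \<open>T / \<Delta> T\<close> tend to infinity. The comparison function \<open>g\<close> converges
  because its phase tends to zero and its exponent differs from the Gaussian one by a factor tending
  to 1.\<close>

lemma char_path_xi_tendsto:
  assumes \<theta>: "\<theta> > 0" and \<Delta>: "\<And>T. \<Delta> T > 0" and lim: "filterlim (\<lambda>T. T / \<Delta> T) at_top at_top"
  shows "((\<lambda>T. char (distr (path_law \<theta>) borel (path_xi \<theta> T (\<Delta> T))) u)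
          \<longlongrightarrow> of_real (exp (- (u\<^sup>2) / 2))) at_top"
proof -
  define r where "r T = T / \<Delta> T" for T
  have r: "filterlim r at_top at_top" using lim by (simp add: r_def[abs_def])
  let ?b = "\<lambda>T. qv_bias \<theta> T (\<Delta> T) / qv_scale \<theta> T (\<Delta> T)"
  define g where "g T = iexp (u * ?b T) * of_real (exp (- (u\<^sup>2 / (2 * r T))) ^ nat \<lfloor>r T\<rfloor>)" for T
  have inv: "((\<lambda>T. 1 / sqrt (r T)) \<longlongrightarrow> 0) at_top"
    by (rule filterlim_compose[OF _ r, of "\<lambda>x. 1 / sqrt x"]) real_asymp
  have inv1: "((\<lambda>T. u ^ 4 / 4 / r T) \<longlongrightarrow> 0) at_top"
    by (rule filterlim_compose[OF _ r, of "\<lambda>x. u ^ 4 / 4 / x"]) real_asymp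
  have inv2: "((\<lambda>T. 1 / sqrt (\<theta> * T)) \<longlongrightarrow> 0) at_top"
    using \<theta> by real_asymp
  have b: "(?b \<longlongrightarrow> 0) at_top"
  proof (rule Lim_null_comparison[OF _ inv])
    show "\<forall>\<^sub>F T in at_top. norm (?b T) \<le> 1 / sqrt (r T)"
      using eventually_gt_at_top[of 0]
      by eventually_elim (use qv_bias_bound[OF \<theta> _ \<Delta>] in \<open>simp add: r_def\<close>)
  qed
  have ratio: "((\<lambda>T. real (nat \<lfloor>r T\<rfloor>) / r T) \<longlongrightarrow> 1) at_top"
    by (rule filterlim_compose[OF floor_div_self_tendsto r])
  have "((\<lambda>T. iexp (u * ?b T) * of_real (exp (- (u\<^sup>2 / 2) * (real (nat \<lfloor>r T\<rfloor>) / r T))))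
      \<longlongrightarrow> iexp (u * 0) * of_real (exp (- (u\<^sup>2 / 2) * 1))) at_top"
    by (intro tendsto_intros b ratio)
  \<comment> \<open>The power becomes a single exponential in which the ratio of
    \<open>T / \<Delta>\<close> rounded down to itself stands alone, so that its limit
    applies.\<close>
  moreover have "of_real (exp (- (u\<^sup>2 / (2 * r T))) ^ nat \<lfloor>r T\<rfloor>)
      = complex_of_real (exp (- (u\<^sup>2 / 2) * (real (nat \<lfloor>r T\<rfloor>) / r T)))" for T
    by (subst exp_of_nat_mult[symmetric]) (simp add: field_simps)
  ultimately have g: "(g \<longlongrightarrow> of_real (exp (- (u\<^sup>2) / 2))) at_top"
    by (simp add: g_def[abs_def] del: of_real_exp)
  have "((\<lambda>T. char (distr (path_law \<theta>) borel (path_xi \<theta> T (\<Delta> T))) u - g T) \<longlongrightarrow> 0) at_top"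
  proof (rule Lim_null_comparison)
    show "\<forall>\<^sub>F T in at_top. norm (char (distr (path_law \<theta>) borel (path_xi \<theta> T (\<Delta> T))) u - g T)
        \<le> \<bar>u\<bar> ^ 3 / 6 * (1 / sqrt (\<theta> * T) + 13 * (1 / sqrt (r T))) + u ^ 4 / 4 / r T"
      using eventually_gt_at_top[of 0]
      by eventually_elim (use char_path_xi_approx[OF \<theta> _ \<Delta>, of _ _ u] in \<open>simp add: r_def g_def\<close>)
    have "((\<lambda>T. \<bar>u\<bar> ^ 3 / 6 * (1 / sqrt (\<theta> * T) + 13 * (1 / sqrt (r T))) + u ^ 4 / 4 / r T)
        \<longlongrightarrow> \<bar>u\<bar> ^ 3 / 6 * (0 + 13 * 0) + 0) at_top"
      by (intro tendsto_intros inv inv1 inv2)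
    then show "((\<lambda>T. \<bar>u\<bar> ^ 3 / 6 * (1 / sqrt (\<theta> * T) + 13 * (1 / sqrt (r T))) + u ^ 4 / 4 / r T) \<longlongrightarrow> 0) at_top"
      by simp
  qed
  from tendsto_add[OF this g] show ?thesis by simp
qed

lemma measurable_qv_xi [measurable]:
  assumes [measurable]: "\<And>k. E k \<in> borel_measurable M" "\<And>k. eps k \<in> borel_measurable M"
  shows "qv_xi E eps \<theta> T \<Delta> \<in> borel_measurable M"
  unfolding qv_xi_def[abs_def] qv_est_def by measurable

text \<open>Weak convergence is a notion for sequences of measures here, so the limit in
  \<open>T\<close> is taken along every sequence \<open>Ts\<close> tending to infinity.\<close>

theorem theorem4:
  fixes M :: "'a measure" and E eps :: "nat \<Rightarrow> 'a \<Rightarrow> real"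
    and \<theta> :: real and \<Delta> :: "real \<Rightarrow> real"
  assumes "prob_space M"
    and "\<theta> > 0"
    and "prob_space.indep_vars M (\<lambda>_. borel)
           (\<lambda>j. case j of Inl k \<Rightarrow> E k | Inr k \<Rightarrow> eps k) UNIV"
    and "\<And>k. distributed M lborel (E k) (exponential_density \<theta>)"
    and "\<And>k. eps k \<in> borel_measurable M"
    and "\<And>k. measure M {\<omega>\<in>space M. eps k \<omega> = 1} = 1/2"
    and "\<And>k. measure M {\<omega>\<in>space M. eps k \<omega> = -1} = 1/2"
    and "\<And>T. \<Delta> T > 0"
    and "filterlim (\<lambda>T. T / \<Delta> T) at_top at_top"
  shows "\<forall>Ts :: nat \<Rightarrow> real. filterlim Ts at_top sequentially \<longrightarrow>
           weak_conv_m (\<lambda>n. distr M borel (qv_xi E eps \<theta> (Ts n) (\<Delta> (Ts n))))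
                       std_normal_distribution"
proof (intro allI impI)
  fix Ts :: "nat \<Rightarrow> real" assume Ts: "filterlim Ts at_top sequentially"
  interpret prob_space M by fact
  let ?\<Phi> = "\<lambda>\<omega> k. (E k \<omega>, eps (Suc k) \<omega>)"
  note \<Phi> = distr_eq_path_law[OF assms(3-7)]
  have [measurable]: "?\<Phi> \<in> measurable M (path_law \<theta>)" by (rule \<Phi>)
  have [measurable]: "path_xi \<theta> T D \<in> borel_measurable (path_law \<theta>)" for T D
    by measurable
  \<comment> \<open>The error is a function of the paired sequence, whose law is
    \<open>path_law \<theta>\<close>; hence only the path space matters from here on.\<close>
  have law: "distr M borel (qv_xi E eps \<theta> T D) = distr (path_law \<theta>) borel (path_xi \<theta> T D)" for T D
  proof -
    have "qv_xi E eps \<theta> T D = path_xi \<theta> T D \<circ> ?\<Phi>"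
      by (simp add: fun_eq_iff qv_xi_def qv_est_def cpp_eq_path_cpp[of E eps])
    then have "distr M borel (qv_xi E eps \<theta> T D) = distr (distr M (path_law \<theta>) ?\<Phi>) borel (path_xi \<theta> T D)"
      by (subst distr_distr) auto
    then show ?thesis by (simp only: \<Phi>)
  qed
  interpret Q: prob_space "path_law \<theta>" by (rule prob_space_path_law) fact
  show "weak_conv_m (\<lambda>n. distr M borel (qv_xi E eps \<theta> (Ts n) (\<Delta> (Ts n)))) std_normal_distribution"
    unfolding law
  proof (rule levy_continuity)
    show "real_distribution (distr (path_law \<theta>) borel (path_xi \<theta> (Ts n) (\<Delta> (Ts n))))" for n
      by (rule Q.real_distribution_distr) measurable
    show "real_distribution std_normal_distribution" by (rule real_dist_normal_dist)
    show "(\<lambda>n. char (distr (path_law \<theta>) borel (path_xi \<theta> (Ts n) (\<Delta> (Ts n)))) u)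
        \<longlonglongrightarrow> char std_normal_distribution u" for u
      using filterlim_compose[OF char_path_xi_tendsto[OF assms(2,8,9), of u] Ts]
      by (simp add: char_std_normal_distribution)
  qed
qed

end
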